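(* Let $\mathcal V$ be a decidable congruence class. Given a sequential transducer $\mathcal T$ over an alphabet $\Sigma$, it is decidable whether the transduction realized by $\mathcal T$ is $\mathcal V$-sequential.
   Context: A transduction over a finite alphabet $\Sigma$ is a partial function $f:\Sigma^*\to\Sigma^*$. An automaton $\mathcal A=(Q,\Delta,I,F)$ has $\Delta\subseteq Q\times\Sigma\times Q$; $p\xrightarrow{w}q$ means there is a run on $w$ from $p$ to $q$. It is deterministic if $|I|=1$ and $(p,\sigma,q_1),(p,\sigma,q_2)\in\Delta$ implies $q_1=q_2$. The transition congruence of $\mathcal A$ is $u\approx_{\mathcal A}v$ iff for all $p,q\in Q$: $p\xrightarrow{u}q\Leftrightarrow p\xrightarrow{v}q$. A congruence class $\mathcal V$ assigns to each finite alphabet $\Sigma$ a set $\mathcal V(\Sigma)$ of congruences of finite index on $\Sigma^*$ that is closed under intersection and under taking coarser congruences. A $\mathcal V$-automaton is an automaton whose transition congruence lies in $\mathcal V(\Sigma)$. $\mathcal V$ is decidable if, given a congruence of finite index presented as a monoid morphism $\mu:\Sigma^*\to M$ into a finite monoid (specified by the images of letters; $u\sim v$ iff $\mu(u)=\mu(v)$), membership of this congruence in $\mathcal V(\Sigma)$ is decidable. A transducer $\mathcal T=(\mathcal A,o,i,t)$ consists of an automaton $\mathcal A=(Q,\Delta,I,F)$, an output function $o:\Delta\to\Sigma^*$, an initial output $i:I\to\Sigma^*$ and a final output $t:F\to\Sigma^*$; it realizes the pairs $(u, i(q_0)\,o(\text{run})\,t(q_n))$ over accepting runs $q_0\dots q_n$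 on $u$, where $o(\text{run})$ is the concatenation of the transition outputs. It is sequential if $\mathcal A$ is deterministic (and it realizes a function). A $\mathcal V$-transducer is a transducer whose underlying automaton is a $\mathcal V$-automaton. A transduction is $\mathcal V$-sequential if it is realized by a sequential $\mathcal V$-transducer. *)

theory Defs
  imports Main "HOL-Library.Nat_Bijection"
begin

text \<open>Unary partial recursive functions on natural numbers, with tuples coded by
  the Cantor pairing prod_encode / prod_decode.\<close>

datatype rf = Zero | Succ | Fst | Snd | Comp rf rf | Pair rf rf | Prim rf rf | Mu rf

inductive eval_rf :: "rf \<Rightarrow> nat \<Rightarrow> nat \<Rightarrow> bool" where
  zero: "eval_rf Zero x 0"
| succ: "eval_rf Succ x (Suc x)"
| fst:  "eval_rf Fst x (fst (prod_decode x))"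
| snd:  "eval_rf Snd x (snd (prod_decode x))"
| comp: "eval_rf g x y \<Longrightarrow> eval_rf f y z \<Longrightarrow> eval_rf (Comp f g) x z"
| pair: "eval_rf f x a \<Longrightarrow> eval_rf g x b \<Longrightarrow> eval_rf (Pair f g) x (prod_encode (a, b))"
| prim0: "eval_rf f p y \<Longrightarrow> eval_rf (Prim f g) (prod_encode (0, p)) y"
| primS: "eval_rf (Prim f g) (prod_encode (n, p)) y \<Longrightarrow>
          eval_rf g (prod_encode (n, prod_encode (y, p))) z \<Longrightarrow>
          eval_rf (Prim f g) (prod_encode (Suc n, p)) z"
| mu: "eval_rf f (prod_encode (n, p)) 0 \<Longrightarrow>
       (\<forall>m<n. \<exists>y. eval_rf f (prod_encode (m, p)) (Suc y)) \<Longrightarrow>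
       eval_rf (Mu f) p n"

fun enc_list :: "nat list \<Rightarrow> nat" where
  "enc_list [] = 0"
| "enc_list (x # xs) = Suc (prod_encode (x, enc_list xs))"

text \<open>Letters are natural numbers; an alphabet is a finite set of naturals.\<close>

definition fin_index_cong :: "nat set \<Rightarrow> (nat list \<times> nat list) set \<Rightarrow> bool" where
  "fin_index_cong \<Sigma> R \<longleftrightarrow>
     equiv (lists \<Sigma>) R \<and>
     (\<forall>u v x y. (u, v) \<in> R \<longrightarrow> (x, y) \<in> R \<longrightarrow> (u @ x, v @ y) \<in> R) \<and>
     finite (lists \<Sigma> // R)"

definition congruence_class :: "(nat set \<Rightarrow> (nat list \<times> nat list) set set) \<Rightarrow> bool" where
  "congruence_class V \<longleftrightarrow>
     (\<forall>\<Sigma>. finite \<Sigma> \<longrightarrow>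
        (\<forall>R \<in> V \<Sigma>. fin_index_cong \<Sigma> R) \<and>
        (\<forall>R \<in> V \<Sigma>. \<forall>S \<in> V \<Sigma>. R \<inter> S \<in> V \<Sigma>) \<and>
        (\<forall>R \<in> V \<Sigma>. \<forall>S. fin_index_cong \<Sigma> S \<and> R \<subseteq> S \<longrightarrow> S \<in> V \<Sigma>))"

definition is_automaton :: "nat set \<Rightarrow> nat set \<Rightarrow> (nat \<times> nat \<times> nat) set \<Rightarrow> nat set \<Rightarrow> nat set \<Rightarrow> bool" where
  "is_automaton \<Sigma> Q \<Delta> I F \<longleftrightarrow> finite Q \<and> \<Delta> \<subseteq> Q \<times> \<Sigma> \<times> Q \<and> I \<subseteq> Q \<and> F \<subseteq> Q"

definition run :: "(nat \<times> nat \<times> nat) set \<Rightarrow> nat list \<Rightarrow> nat list \<Rightarrow> bool" where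
  "run \<Delta> qs w \<longleftrightarrow> length qs = Suc (length w) \<and>
     (\<forall>j < length w. (qs ! j, w ! j, qs ! Suc j) \<in> \<Delta>)"

definition reach :: "(nat \<times> nat \<times> nat) set \<Rightarrow> nat \<Rightarrow> nat list \<Rightarrow> nat \<Rightarrow> bool" where
  "reach \<Delta> p w q \<longleftrightarrow> (\<exists>qs. run \<Delta> qs w \<and> hd qs = p \<and> last qs = q)"

definition deterministic :: "nat set \<Rightarrow> (nat \<times> nat \<times> nat) set \<Rightarrow> bool" where
  "deterministic I \<Delta> \<longleftrightarrow> card I = 1 \<and>
     (\<forall>p a q1 q2. (p, a, q1) \<in> \<Delta> \<longrightarrow> (p, a, q2) \<in> \<Delta> \<longrightarrow> q1 = q2)"

definition trans_cong :: "nat set \<Rightarrow> nat set \<Rightarrow> (nat \<times> nat \<times> nat) set \<Rightarrow> (nat list \<times> nat list) set" where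
  "trans_cong \<Sigma> Q \<Delta> = {(u, v). u \<in> lists \<Sigma> \<and> v \<in> lists \<Sigma> \<and>
      (\<forall>p \<in> Q. \<forall>q \<in> Q. reach \<Delta> p u q \<longleftrightarrow> reach \<Delta> p v q)}"

definition is_transducer :: "nat set \<Rightarrow> nat set \<Rightarrow> (nat \<times> nat \<times> nat) set \<Rightarrow> nat set \<Rightarrow> nat set
     \<Rightarrow> (nat \<times> nat \<times> nat \<Rightarrow> nat list) \<Rightarrow> (nat \<Rightarrow> nat list) \<Rightarrow> (nat \<Rightarrow> nat list) \<Rightarrow> bool" where
  "is_transducer \<Sigma> Q \<Delta> I F out i t \<longleftrightarrow> is_automaton \<Sigma> Q \<Delta> I F \<and>
     (\<forall>d \<in> \<Delta>. out d \<in> lists \<Sigma>) \<and> (\<forall>q \<in> I. i q \<in> lists \<Sigma>) \<and> (\<forall>q \<in> F. t q \<in> lists \<Sigma>)"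

definition realized :: "(nat \<times> nat \<times> nat) set \<Rightarrow> nat set \<Rightarrow> nat set
     \<Rightarrow> (nat \<times> nat \<times> nat \<Rightarrow> nat list) \<Rightarrow> (nat \<Rightarrow> nat list) \<Rightarrow> (nat \<Rightarrow> nat list) \<Rightarrow> (nat list \<times> nat list) set" where
  "realized \<Delta> I F out i t =
     {(u, i (hd qs) @ concat (map (\<lambda>j. out (qs ! j, u ! j, qs ! Suc j)) [0..<length u]) @ t (last qs))
      | u qs. run \<Delta> qs u \<and> hd qs \<in> I \<and> last qs \<in> F}"

definition V_sequential :: "(nat set \<Rightarrow> (nat list \<times> nat list) set set) \<Rightarrow> nat set
     \<Rightarrow> (nat list \<Rightarrow> nat list option) \<Rightarrow> bool" where
  "V_sequential V \<Sigma> f \<longleftrightarrow>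
     (\<exists>Q \<Delta> I F out i t. is_transducer \<Sigma> Q \<Delta> I F out i t \<and> deterministic I \<Delta> \<and>
        trans_cong \<Sigma> Q \<Delta> \<in> V \<Sigma> \<and>
        (\<forall>u v. (u, v) \<in> realized \<Delta> I F out i t \<longleftrightarrow> f u = Some v))"

definition transduction_of :: "(nat list \<times> nat list) set \<Rightarrow> nat list \<Rightarrow> nat list option" where
  "transduction_of R u = (if \<exists>v. (u, v) \<in> R then Some (THE v. (u, v) \<in> R) else None)"

text \<open>Alphabet sig (list of distinct letters), monoid {0..<m} with multiplication table tab
  (tab ! a ! b = a*b), unit e, and img ! k = image of the letter sig ! k.\<close>
definition valid_pres :: "nat list \<Rightarrow> nat \<Rightarrow> nat list list \<Rightarrow> nat \<Rightarrow> nat list \<Rightarrow> bool" where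
  "valid_pres sig m tab e img \<longleftrightarrow>
     distinct sig \<and> length img = length sig \<and> (\<forall>x \<in> set img. x < m) \<and> e < m \<and>
     length tab = m \<and> (\<forall>row \<in> set tab. length row = m \<and> (\<forall>x \<in> set row. x < m)) \<and>
     (\<forall>a<m. \<forall>b<m. \<forall>c<m. tab ! (tab ! a ! b) ! c = tab ! a ! (tab ! b ! c)) \<and>
     (\<forall>a<m. tab ! e ! a = a \<and> tab ! a ! e = a)"

definition pres_morph :: "nat list \<Rightarrow> nat list list \<Rightarrow> nat \<Rightarrow> nat list \<Rightarrow> nat list \<Rightarrow> nat" where
  "pres_morph sig tab e img u = foldl (\<lambda>a x. tab ! a ! the (map_of (zip sig img) x)) e u"

definition pres_cong :: "nat list \<Rightarrow> nat list list \<Rightarrow> nat \<Rightarrow> nat list \<Rightarrow> (nat list \<times> nat list) set" where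
  "pres_cong sig tab e img = {(u, v). u \<in> lists (set sig) \<and> v \<in> lists (set sig) \<and>
      pres_morph sig tab e img u = pres_morph sig tab e img v}"

definition enc_pres :: "nat list \<Rightarrow> nat \<Rightarrow> nat list list \<Rightarrow> nat \<Rightarrow> nat list \<Rightarrow> nat" where
  "enc_pres sig m tab e img =
     prod_encode (enc_list sig, prod_encode (m, prod_encode (enc_list (map enc_list tab),
       prod_encode (e, enc_list img))))"

definition decidable_class :: "(nat set \<Rightarrow> (nat list \<times> nat list) set set) \<Rightarrow> bool" where
  "decidable_class V \<longleftrightarrow> (\<exists>r. \<forall>sig m tab e img. valid_pres sig m tab e img \<longrightarrow>
      eval_rf r (enc_pres sig m tab e img) (if pres_cong sig tab e img \<in> V (set sig) then 1 else 0))"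

text \<open>Alphabet sig, states {0..<n}, initial state q0 with initial output iout,
  transitions (p, a, q, output), final states with final outputs.\<close>
definition valid_seq :: "nat list \<Rightarrow> nat \<Rightarrow> nat \<Rightarrow> nat list \<Rightarrow> (nat \<times> nat \<times> nat \<times> nat list) list
     \<Rightarrow> (nat \<times> nat list) list \<Rightarrow> bool" where
  "valid_seq sig n q0 iout trs fin \<longleftrightarrow>
     distinct sig \<and> q0 < n \<and> iout \<in> lists (set sig) \<and>
     (\<forall>(p, a, q, w) \<in> set trs. p < n \<and> a \<in> set sig \<and> q < n \<and> w \<in> lists (set sig)) \<and>
     distinct (map (\<lambda>(p, a, q, w). (p, a)) trs) \<and>
     (\<forall>(q, w) \<in> set fin. q < n \<and> w \<in> lists (set sig)) \<and> distinct (map fst fin)"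

definition seq_transduction :: "nat \<Rightarrow> nat list \<Rightarrow> (nat \<times> nat \<times> nat \<times> nat list) list
     \<Rightarrow> (nat \<times> nat list) list \<Rightarrow> nat list \<Rightarrow> nat list option" where
  "seq_transduction q0 iout trs fin = transduction_of
     (realized ((\<lambda>(p, a, q, w). (p, a, q)) ` set trs) {q0} (fst ` set fin)
        (\<lambda>d. the (map_of (map (\<lambda>(p, a, q, w). ((p, a, q), w)) trs) d))
        (\<lambda>_. iout) (\<lambda>q. the (map_of fin q)))"

definition enc_seq :: "nat list \<Rightarrow> nat \<Rightarrow> nat \<Rightarrow> nat list \<Rightarrow> (nat \<times> nat \<times> nat \<times> nat list) list
     \<Rightarrow> (nat \<times> nat list) list \<Rightarrow> nat" where
  "enc_seq sig n q0 iout trs fin =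
     prod_encode (enc_list sig, prod_encode (n, prod_encode (q0, prod_encode (enc_list iout,
       prod_encode (enc_list (map (\<lambda>(p, a, q, w). prod_encode (p, prod_encode (a, prod_encode (q, enc_list w)))) trs),
         enc_list (map (\<lambda>(q, w). prod_encode (q, enc_list w)) fin))))))"

end

theory Submission
  imports Defs "HOL-Library.Sublist"
begin

text \<open>Call the shape of a partial function h the function that maps a pair of arguments to the two
  values with their common prefix removed; it determines h up to exchanging a prefix common to all
  values. For a transduction f, let two words x, y be congruent if for every u the functions
  w \<mapsto> f (u x w) and w \<mapsto> f (u y w) have the same shape. The transition congruence of every
  sequential transducer realizing f refines this congruence, and the transducer whose states are
  the shapes of the residuals of f, each output being produced as early as possible, attains it.
  As V is closed under coarser congruences, f is V-sequential iff this congruence is in V.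

  A monoid presenting the congruence is found by unbounded search. A certificate consists of words W
  such that residuals of equal shape on W still have equal shape on the words of W prolonged by one
  letter to the left, which makes W decide equality of shapes, and of representatives Z of the
  congruence classes.\<close>

text \<open>The class V constrains the automaton alone, so a transducer may emit its output earlier
  or later at no cost; hence residuals are compared up to a common prefix. Shapes compare two values
  at a time instead of dividing off the longest common prefix, because two values can be computed
  and compared whereas that prefix depends on infinitely many of them. By
  \<open>shape_eq_drop_lcp\<close> nothing is lost. The algorithm has to be an explicit
  \<open>rf\<close> term. Minimising the transducer directly would mean programming the minimisation
  and bounding its running time inside \<open>rf\<close>; with certificates only the check must be
  computable, and the search halts because every valid input has a certificate. Two finiteness
  arguments make the check sound. Stability of W under one-letter prolongation spreads to all words
  by induction on length. The left contexts of the congruence may be restricted to Z, because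
  closure of Z under products up to equivalence makes every word over the alphabet have the residual
  of some entry of Z.\<close>

section \<open>Computable functions on encodable types\<close>

text \<open>Codes are bijective, not merely injective: injectivity lets equality be tested on codes,
  and surjectivity makes every number visited by a search or a recursion the code of some
  value.\<close>

class encodable =
  fixes enc :: "'a \<Rightarrow> nat"
  assumes bij_enc: "bij enc"
begin

lemma enc_eq_iff [simp]: "enc x = enc y \<longleftrightarrow> x = y"
  using bij_enc by (simp add: bij_def inj_eq)

end

instantiation nat :: encodable
begin
definition enc_nat [simp]: "enc n = (n :: nat)"
instance by standard (simp add: bij_def inj_def surj_def)
end

instantiation prod :: (encodable, encodable) encodable
begin
definition enc_prod: "enc p = prod_encode (map_prod enc enc p)" for p :: "'a \<times> 'b"
instance
proof
  have "bij (map_prod enc enc :: 'a \<times> 'b \<Rightarrow> nat \<times> nat)"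
    unfolding bij_def
    by (intro conjI prod.inj_map map_prod_surj bij_is_inj bij_is_surj bij_enc)
  then have "bij (prod_encode \<circ> (map_prod enc enc :: 'a \<times> 'b \<Rightarrow> nat \<times> nat))"
    using bij_prod_encode by (rule bij_comp)
  then show "bij (enc :: 'a \<times> 'b \<Rightarrow> nat)"
    by (simp add: enc_prod[abs_def] comp_def)
qed
end

instantiation list :: (encodable) encodable
begin
definition enc_list_code: "enc xs = list_encode (map enc xs)" for xs :: "'a list"
instance
proof
  have "map enc (map (inv (enc :: 'a \<Rightarrow> nat)) ns) = ns" for ns
    by (simp add: comp_def surj_f_inv_f[OF bij_is_surj[OF bij_enc]])
  then have "bij (map (enc :: 'a \<Rightarrow> nat))"
    unfolding bij_def by (intro conjI list.inj_map bij_is_inj bij_enc surjI)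
  then have "bij (list_encode \<circ> map (enc :: 'a \<Rightarrow> nat))"
    using bij_list_encode by (rule bij_comp)
  then show "bij (enc :: 'a list \<Rightarrow> nat)"
    by (simp add: enc_list_code[abs_def] comp_def)
qed
end

lemma enc_Pair [simp]: "enc (a, b) = prod_encode (enc a, enc b)"
  by (simp add: enc_prod)

lemma enc_Nil [simp]: "enc [] = 0"
  by (simp add: enc_list_code)

lemma enc_Cons [simp]: "enc (x # xs) = Suc (prod_encode (enc x, enc xs))"
  by (simp add: enc_list_code)

definition computable :: "('a::encodable \<Rightarrow> 'b::encodable) \<Rightarrow> bool" where
  "computable f \<longleftrightarrow> (\<exists>r. \<forall>x. eval_rf r (enc x) (enc (f x)))"

definition decidable :: "('a::encodable \<Rightarrow> bool) \<Rightarrow> bool" where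
  "decidable P \<longleftrightarrow> computable (\<lambda>x. of_bool (P x) :: nat)"

named_theorems computable_intros

lemma computableI: "(\<And>x. eval_rf r (enc x) (enc (f x))) \<Longrightarrow> computable f"
  unfolding computable_def by blast

lemma computableE:
  assumes "computable f"
  obtains r where "\<And>x. eval_rf r (enc x) (enc (f x))"
  using assms unfolding computable_def by blast

lemma eval_rf_id: "eval_rf (Pair Fst Snd) x x"
  using eval_rf.pair[OF eval_rf.fst[of x] eval_rf.snd[of x]] by simp

lemma computable_id [computable_intros]: "computable (\<lambda>x. x)"
  by (rule computableI[OF eval_rf_id])

lemma computable_comp:
  assumes "computable f" "computable g"
  shows "computable (\<lambda>x. f (g x))"
  using assms unfolding computable_def by (meson eval_rf.comp)

lemma computable_const [computable_intros]: "computable (\<lambda>x. c)"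
proof -
  have "\<exists>r. \<forall>x. eval_rf r x n" for n
    by (induction n) (meson eval_rf.zero, meson eval_rf.succ eval_rf.comp)
  then show ?thesis unfolding computable_def by blast
qed

lemma computable_Pair [computable_intros]:
  assumes "computable f" "computable g"
  shows "computable (\<lambda>x. (f x, g x))"
  using assms unfolding computable_def enc_Pair by (meson eval_rf.pair)

lemma computable_fst [computable_intros]:
  fixes f :: "'a::encodable \<Rightarrow> 'b::encodable \<times> 'c::encodable"
  assumes "computable f"
  shows "computable (\<lambda>x. fst (f x))"
proof -
  have "eval_rf Fst (enc p) (enc (fst p))" for p :: "'b \<times> 'c"
    using eval_rf.fst[of "enc p"] by (cases p) simp
  then show ?thesis by (intro computable_comp[OF computableI assms])
qed

lemma computable_snd [computable_intros]:
  fixes f :: "'a::encodable \<Rightarrow> 'c::encodable \<times> 'b::encodable"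
  assumes "computable f"
  shows "computable (\<lambda>x. snd (f x))"
proof -
  have "eval_rf Snd (enc p) (enc (snd p))" for p :: "'c \<times> 'b"
    using eval_rf.snd[of "enc p"] by (cases p) simp
  then show ?thesis by (intro computable_comp[OF computableI assms])
qed

lemma computable_case_prod [computable_intros]:
  assumes "computable (\<lambda>x. f x (fst (g x)) (snd (g x)))"
  shows "computable (\<lambda>x. case g x of (a, b) \<Rightarrow> f x a b)"
  using assms by (simp add: case_prod_beta)

lemma computable_Suc [computable_intros]:
  assumes "computable f"
  shows "computable (\<lambda>x. Suc (f x))"
  by (rule computable_comp[OF _ assms], rule computableI[of Succ]) (simp add: eval_rf.succ)

lemma computable_enc [computable_intros]:
  assumes "computable f"
  shows "computable (\<lambda>x. enc (f x))"
  using assms unfolding computable_def by simp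

text \<open>\<open>Prim\<close> hands its step function the tuple (counter, (previous value,
  parameter)), so the bound variables of \<open>g\<close> are packed with \<open>x\<close> into one
  argument \<open>q\<close>. The later rules for higher-order functions use the same device.\<close>

lemma computable_rec_nat [computable_intros]:
  assumes "computable a" "computable n"
    and "computable (\<lambda>q. g (snd (snd q)) (fst q) (fst (snd q)))"
  shows "computable (\<lambda>x. rec_nat (a x) (g x) (n x))"
proof -
  obtain ra where ra: "\<And>x. eval_rf ra (enc x) (enc (a x))"
    using assms(1) by (rule computableE) blast
  obtain rg where rg: "\<And>k y x. eval_rf rg (enc (k, y, x)) (enc (g x k y))"
  proof -
    obtain r where "\<And>q. eval_rf r (enc q) (enc (g (snd (snd q)) (fst q) (fst (snd q))))"
      using assms(3) by (rule computableE) blast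
    from this[of "(_, _, _)"] show thesis by (intro that) simp
  qed
  have "eval_rf (Prim ra rg) (prod_encode (k, enc x)) (enc (rec_nat (a x) (g x) k))" for k x
    by (induction k) (use ra rg[of _ _ x] in \<open>auto intro: eval_rf.intros\<close>)
  then have "computable (\<lambda>p. rec_nat (a (snd p)) (g (snd p)) (fst p))"
    by (intro computableI[of "Prim ra rg"]) auto
  from computable_comp[OF this computable_Pair[OF assms(2) computable_id]] show ?thesis
    by simp
qed

text \<open>A recursion of length 0 or 1 selects the branch. Both branches are total, so evaluating
  the base case as well does no harm.\<close>

lemma computable_if [computable_intros]:
  assumes "decidable P" "computable f" "computable g"
  shows "computable (\<lambda>x. if P x then f x else g x)"
proof -
  have "computable (\<lambda>x. rec_nat (g x) (\<lambda>_ _. f x) (of_bool (P x)))"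
    by (intro computable_intros assms assms(1)[unfolded decidable_def]
        computable_comp[OF assms(2)])
  moreover have "(\<lambda>x. rec_nat (g x) (\<lambda>_ _. f x) (of_bool (P x))) = (\<lambda>x. if P x then f x else g x)"
    by auto
  ultimately show ?thesis by simp
qed

lemma decidable_not [computable_intros]:
  assumes "decidable P"
  shows "decidable (\<lambda>x. \<not> P x)"
proof -
  have "computable (\<lambda>x. if P x then 0 else 1 :: nat)"
    by (intro computable_intros assms)
  moreover have "(\<lambda>x. if P x then 0 else 1 :: nat) = (\<lambda>x. of_bool (\<not> P x))"
    by auto
  ultimately show ?thesis unfolding decidable_def by simp
qed

lemma decidable_conj [computable_intros]:
  assumes "decidable P" "decidable Q"
  shows "decidable (\<lambda>x. P x \<and> Q x)"
proof -
  have "computable (\<lambda>x. if P x then of_bool (Q x) else 0 :: nat)"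
    using assms(2) by (intro computable_intros assms) (simp add: decidable_def)
  moreover have "(\<lambda>x. if P x then of_bool (Q x) else 0 :: nat) = (\<lambda>x. of_bool (P x \<and> Q x))"
    by auto
  ultimately show ?thesis unfolding decidable_def by simp
qed

lemma decidable_imp [computable_intros]:
  assumes "decidable P" "decidable Q"
  shows "decidable (\<lambda>x. P x \<longrightarrow> Q x)"
proof -
  have "decidable (\<lambda>x. \<not> (P x \<and> \<not> Q x))"
    by (intro computable_intros assms)
  then show ?thesis by simp
qed

lemma computable_diff [computable_intros]:
  assumes "computable f" "computable g"
  shows "computable (\<lambda>x. f x - g x :: nat)"
proof -
  have pred: "rec_nat 0 (\<lambda>k _. k) m = m - 1" for m :: nat
    by (cases m) auto
  have "computable (\<lambda>x. rec_nat (f x) (\<lambda>_ y. rec_nat 0 (\<lambda>k _. k) y) (g x))"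
    by (intro computable_intros assms)
  moreover have "rec_nat m (\<lambda>_ y. rec_nat 0 (\<lambda>k _. k) y) n = m - n" for m n :: nat
    by (induction n) (simp_all add: pred)
  ultimately show ?thesis by simp
qed

lemma decidable_less [computable_intros]:
  assumes "computable f" "computable g"
  shows "decidable (\<lambda>x. f x < (g x :: nat))"
proof -
  have "computable (\<lambda>x. rec_nat 0 (\<lambda>_ _. 1) (g x - f x) :: nat)"
    by (intro computable_intros assms)
  moreover have "rec_nat 0 (\<lambda>_ _. 1) (n - m) = (of_bool (m < n) :: nat)" for m n :: nat
    by (cases "n - m") auto
  ultimately show ?thesis unfolding decidable_def by simp
qed

lemma decidable_eq [computable_intros]:
  assumes "computable f" "computable g"
  shows "decidable (\<lambda>x. f x = g x)"
proof -
  have "decidable (\<lambda>x. \<not> enc (f x) < enc (g x) \<and> \<not> enc (g x) < enc (f x))"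
    by (intro computable_intros assms)
  moreover have "\<not> enc a < enc b \<and> \<not> enc b < enc a \<longleftrightarrow> a = b" for a b :: 'b
    using enc_eq_iff[of a b] by linarith
  ultimately show ?thesis by simp
qed

section \<open>Lists: case distinction, folds and bounded quantification\<close>

lemma computable_Cons [computable_intros]:
  assumes "computable f" "computable g"
  shows "computable (\<lambda>x. f x # g x)"
  using computable_Suc[OF computable_enc[OF computable_Pair[OF assms]]]
  unfolding computable_def by simp

lemma computable_case_list [computable_intros]:
  assumes "computable a" "computable l"
    and "computable (\<lambda>q. g (snd q) (fst (fst q)) (snd (fst q)))"
  shows "computable (\<lambda>x. case l x of [] \<Rightarrow> a x | y # ys \<Rightarrow> g x y ys)"
proof -
  obtain ra where ra: "\<And>x. eval_rf ra (enc x) (enc (a x))"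
    using assms(1) by (rule computableE) blast
  obtain rg where rg: "\<And>y ys x. eval_rf rg (enc ((y, ys), x)) (enc (g x y ys))"
  proof -
    obtain r where "\<And>q. eval_rf r (enc q) (enc (g (snd q) (fst (fst q)) (snd (fst q))))"
      using assms(3) by (rule computableE) blast
    from this[of "((_, _), _)"] show thesis by (intro that) simp
  qed
  define rc where "rc = Prim ra (Comp rg (Pair Fst (Comp Snd Snd)))"
  let ?h = "\<lambda>(l, x). case l of [] \<Rightarrow> a x | y # ys \<Rightarrow> g x y ys"
  \<comment> \<open>A nonempty list has code \<open>Suc (enc (y, ys))\<close>, so the counter that
    \<open>Prim\<close> passes to its last step is the code of head and tail. The previous value is
    discarded, but it must exist, hence the claim for every number \<open>k\<close>.\<close>
  have "\<exists>v. eval_rf rc (prod_encode (k, enc x)) v \<and>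
      (\<forall>l. enc l = k \<longrightarrow> v = enc (?h (l, x)))" for k x
  proof (induction k)
    case 0
    then show ?case unfolding rc_def using eval_rf.prim0[OF ra[of x]]
      by (metis (mono_tags, lifting) case_prod_conv enc_Nil enc_eq_iff list.simps(4))
  next
    case (Suc k)
    then obtain v where v: "eval_rf rc (prod_encode (k, enc x)) v" by blast
    obtain p :: "'c \<times> 'c list" where p: "k = enc p"
      using bij_enc unfolding bij_def surj_def by blast
    have "eval_rf (Pair Fst (Comp Snd Snd)) (prod_encode (k, prod_encode (v, enc x)))
        (prod_encode (k, enc x))"
      using eval_rf.fst[of "prod_encode (k, prod_encode (v, enc x))"]
        eval_rf.snd[of "prod_encode (k, prod_encode (v, enc x))"]
        eval_rf.snd[of "prod_encode (v, enc x)"]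
      by (auto intro!: eval_rf.pair intro: eval_rf.comp)
    then have "eval_rf (Comp rg (Pair Fst (Comp Snd Snd)))
        (prod_encode (k, prod_encode (v, enc x))) (enc (g x (fst p) (snd p)))"
      using rg[of "fst p" "snd p" x] unfolding p by (auto intro: eval_rf.comp)
    then have "eval_rf rc (prod_encode (Suc k, enc x)) (enc (g x (fst p) (snd p)))"
      using v unfolding rc_def by (auto intro: eval_rf.primS)
    moreover have "l = fst p # snd p" if "enc l = Suc k" for l
      using that unfolding p by (cases l; cases p) simp_all
    ultimately show ?case by force
  qed
  then have "eval_rf rc (enc (l, x)) (enc (?h (l, x)))" for l x
    by (metis enc_Pair)
  then have "computable ?h"
    by (intro computableI[of rc]) (metis surj_pair)
  from computable_comp[OF this computable_Pair[OF assms(2) computable_id]] show ?thesis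
    by simp
qed

lemma computable_funpow [computable_intros]:
  fixes f :: "'a::encodable \<Rightarrow> 'b::encodable \<Rightarrow> 'b"
  assumes "computable a" "computable n" "computable (\<lambda>q. f (snd q) (fst q))"
  shows "computable (\<lambda>x. (f x ^^ n x) (a x))"
proof -
  have "computable (\<lambda>x. rec_nat (a x) (\<lambda>_. f x) (n x))"
    using computable_comp[OF assms(3), of "\<lambda>q. (fst (snd q), snd (snd q))"]
    by (intro computable_intros assms) (simp add: computable_intros)
  moreover have "rec_nat (a x) (\<lambda>_. f x) n = (f x ^^ n) (a x)" for x n
    by (induction n) simp_all
  ultimately show ?thesis by simp
qed

lemma length_le_enc: "length xs \<le> enc xs"
  by (induction xs) (auto intro: order.trans le_prod_encode_2)

text \<open>The code of a list bounds its length, so it serves as the number of iterations.\<close>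

lemma computable_foldl [computable_intros]:
  assumes "computable (\<lambda>q. f (snd q) (fst (fst q)) (snd (fst q)))" "computable a" "computable l"
  shows "computable (\<lambda>x. foldl (f x) (a x) (l x))"
proof -
  \<comment> \<open>The state holds the unread input and the accumulator. On exhausted input
    \<open>pop\<close> is the identity, so surplus iterations change nothing.\<close>
  define pop where
    "pop x p = (case fst p of [] \<Rightarrow> p | y # ys \<Rightarrow> (ys, f x (snd p) y))" for x p
  have pop: "(pop x ^^ n) (l, a) = (drop n l, foldl (f x) a (take n l))" for x n l a
  proof (induction n arbitrary: l a)
    case (Suc n)
    have "pop x (l, a) = (drop 1 l, foldl (f x) a (take 1 l))"
      by (cases l) (simp_all add: pop_def)
    then show ?case
      by (simp add: funpow_Suc_right Suc.IH del: funpow.simps) (cases l; simp)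
  qed simp
  have "computable (\<lambda>x. (pop x ^^ enc (l x)) (l x, a x))"
    unfolding pop_def
    using computable_comp[OF assms(1),
        of "\<lambda>q. ((snd (fst (snd q)), fst (fst q)), snd (snd q))"]
    by (intro computable_intros assms) (simp add: computable_intros)
  then have "computable (\<lambda>x. snd ((pop x ^^ enc (l x)) (l x, a x)))"
    by (rule computable_snd)
  then show ?thesis by (simp add: pop length_le_enc)
qed

lemma computable_rev [computable_intros]:
  assumes "computable f"
  shows "computable (\<lambda>x. rev (f x))"
proof -
  have "computable (\<lambda>x. foldl (\<lambda>xs y. y # xs) [] (f x))"
    by (intro computable_intros assms)
  moreover have "foldl (\<lambda>xs y. y # xs) ys zs = rev zs @ ys" for ys zs :: "'b list"
    by (induction zs arbitrary: ys) simp_all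
  ultimately show ?thesis by simp
qed

lemma computable_foldr [computable_intros]:
  assumes "computable (\<lambda>q. f (snd q) (snd (fst q)) (fst (fst q)))" "computable l" "computable a"
  shows "computable (\<lambda>x. foldr (f x) (l x) (a x))"
  unfolding foldr_conv_foldl by (intro computable_intros assms)

lemma computable_append [computable_intros]:
  assumes "computable f" "computable g"
  shows "computable (\<lambda>x. f x @ g x)"
proof -
  have "computable (\<lambda>x. foldr (\<lambda>y ys. y # ys) (f x) (g x))"
    by (intro computable_intros assms)
  moreover have "foldr (\<lambda>y ys. y # ys) xs ys = xs @ ys" for xs ys :: "'b list"
    by (induction xs) simp_all
  ultimately show ?thesis by simp
qed

lemma computable_map [computable_intros]:
  assumes "computable (\<lambda>q. f (snd q) (fst q))" "computable l"
  shows "computable (\<lambda>x. map (f x) (l x))"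
proof -
  have "computable (\<lambda>x. foldr (\<lambda>y ys. f x y # ys) (l x) [])"
    using computable_comp[OF assms(1), of "\<lambda>q. (snd (fst q), snd q)"]
    by (intro computable_intros assms) (simp add: computable_intros)
  moreover have "foldr (\<lambda>y ys. f x y # ys) xs [] = map (f x) xs" for x xs
    by (induction xs) simp_all
  ultimately show ?thesis by simp
qed

lemma computable_concat [computable_intros]:
  assumes "computable f"
  shows "computable (\<lambda>x. concat (f x))"
  unfolding concat_conv_foldr by (intro computable_intros assms)

lemma computable_length [computable_intros]:
  assumes "computable f"
  shows "computable (\<lambda>x. length (f x))"
proof -
  have "computable (\<lambda>x. foldr (\<lambda>_ n. Suc n) (f x) 0)"
    by (intro computable_intros assms)
  moreover have "foldr (\<lambda>_ n. Suc n) xs 0 = length xs" for xs :: "'b list"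
    by (induction xs) simp_all
  ultimately show ?thesis by simp
qed

lemma computable_upt [computable_intros]:
  assumes "computable f"
  shows "computable (\<lambda>x. [0..<f x])"
proof -
  have "computable (\<lambda>x. rec_nat [] (\<lambda>k xs. xs @ [k]) (f x))"
    by (intro computable_intros assms)
  moreover have "rec_nat [] (\<lambda>k xs. xs @ [k]) n = [0..<n]" for n
    by (induction n) simp_all
  ultimately show ?thesis by simp
qed

lemma computable_takeWhile [computable_intros]:
  assumes "decidable (\<lambda>q. P (snd q) (fst q))" "computable l"
  shows "computable (\<lambda>x. takeWhile (P x) (l x))"
proof -
  have "computable (\<lambda>x. foldr (\<lambda>y ys. if P x y then y # ys else []) (l x) [])"
    using computable_comp[OF assms(1)[unfolded decidable_def], of "\<lambda>q. (snd (fst q), snd q)"]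
    by (intro computable_intros assms) (simp_all add: decidable_def computable_intros)
  moreover have "foldr (\<lambda>y ys. if P x y then y # ys else []) xs [] = takeWhile (P x) xs"
    for x xs
    by (induction xs) simp_all
  ultimately show ?thesis by simp
qed

lemma decidable_Ball_set [computable_intros]:
  assumes "decidable (\<lambda>q. P (snd q) (fst q))" "computable l"
  shows "decidable (\<lambda>x. \<forall>y \<in> set (l x). P x y)"
proof -
  have "decidable (\<lambda>x. takeWhile (P x) (l x) = l x)"
    by (intro computable_intros assms)
  then show ?thesis by (simp add: takeWhile_eq_all_conv)
qed

text \<open>\<open>Mu\<close> stops at the first zero, hence the search runs on the characteristic
  function of the negation. That function is total, so every earlier candidate yields a successor,
  as \<open>mu\<close> demands. Nothing is promised for inputs without a solution.\<close>

lemma computable_search: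
  fixes P :: "'a::encodable \<Rightarrow> 'b::encodable \<Rightarrow> bool"
  assumes "decidable (\<lambda>q. P (snd q) (fst q))"
  obtains r where "\<And>x. \<exists>y. P x y \<Longrightarrow> \<exists>y. P x y \<and> eval_rf r (enc x) (enc y)"
proof -
  have "computable (\<lambda>q. of_bool (\<not> P (snd q) (fst q)) :: nat)"
    using decidable_not[OF assms] by (simp add: decidable_def)
  then obtain s where s': "eval_rf s (enc q) (enc (of_bool (\<not> P (snd q) (fst q)) :: nat))" for q
    by (rule computableE) blast
  have s: "eval_rf s (prod_encode (enc y, enc x)) (of_bool (\<not> P x y))" for x y
    using s'[of "(y, x)"] by simp
  have dec: "\<exists>y :: 'b. enc y = n" for n
    using bij_enc unfolding bij_def surj_def by metis
  have "\<exists>y. P x y \<and> eval_rf (Mu s) (enc x) (enc y)" if ex: "\<exists>y. P x y" for x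
  proof -
    define n where "n = (LEAST n. \<exists>y. enc y = n \<and> P x y)"
    have "\<exists>n y. enc y = n \<and> P x y" using ex by blast
    from LeastI_ex[OF this] obtain y where y: "enc y = n" "P x y"
      unfolding n_def by blast
    have "\<exists>v. eval_rf s (prod_encode (m, enc x)) (Suc v)" if "m < n" for m
    proof -
      obtain y' :: 'b where y': "enc y' = m" using dec by blast
      with \<open>m < n\<close> have "\<not> P x y'" unfolding n_def using not_less_Least by blast
      with s[of y' x] y' show ?thesis by auto
    qed
    moreover have "eval_rf s (prod_encode (n, enc x)) 0" using s[of y x] y by simp
    ultimately show ?thesis using y by (auto intro: eval_rf.mu)
  qed
  then show ?thesis using that by blast
qed

section \<open>Shapes of partial string functions and the syntactic congruence\<close>

text \<open>The result is the reduced form of x^{-1} y in the free group. This explains both the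
  invariance under a common prefix and the composition law
  \<open>strip_common_trans\<close>.\<close>

fun strip_common :: "'a list \<Rightarrow> 'a list \<Rightarrow> 'a list \<times> 'a list" where
  "strip_common (x # xs) (y # ys) = (if x = y then strip_common xs ys else (x # xs, y # ys))"
| "strip_common xs ys = (xs, ys)"

lemma strip_common_append [simp]: "strip_common (c @ x) (c @ y) = strip_common x y"
  by (induction c) simp_all

lemma strip_common_self [simp]: "strip_common x x = ([], [])"
  by (induction x) simp_all

lemma strip_commonE:
  assumes "strip_common x y = (a, b)"
  obtains c where "x = c @ a" "y = c @ b"
proof -
  have "\<exists>c. x = c @ fst (strip_common x y) \<and> y = c @ snd (strip_common x y)"
  proof (induction x y rule: strip_common.induct)
    case (1 x xs y ys)
    then show ?case by (cases "x = y") (auto intro: exI[of _ "x # _"])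
  qed auto
  then show ?thesis using assms that by auto
qed

lemma length_fst_strip_common_le: "length (fst (strip_common x y)) \<le> length x"
  by (induction x y rule: strip_common.induct) auto

text \<open>In the free group, x^{-1} z = (x^{-1} y)(y^{-1} z). Concretely, the prefixes
  \<open>c\<close> and \<open>d\<close> cut from \<open>y\<close> are comparable; their difference
  \<open>r\<close> is the same for the primed words, because it is determined by the remainders
  \<open>b\<close> and \<open>e\<close>.\<close>

lemma strip_common_trans:
  assumes "strip_common x y = strip_common x' y'" "strip_common y z = strip_common y' z'"
  shows "strip_common x z = strip_common x' z'"
proof -
  obtain a b where ab: "strip_common x y = (a, b)" by fastforce
  obtain e g where eg: "strip_common y z = (e, g)" by fastforce
  obtain c where c: "x = c @ a" "y = c @ b" using ab by (rule strip_commonE)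
  obtain c' where c': "x' = c' @ a" "y' = c' @ b" using ab assms(1) by (metis strip_commonE)
  obtain d where d: "y = d @ e" "z = d @ g" using eg by (rule strip_commonE)
  obtain d' where d': "y' = d' @ e" "z' = d' @ g" using eg assms(2) by (metis strip_commonE)
  have "c @ b = d @ e" "c' @ b = d' @ e" using c c' d d' by auto
  then consider r where "c = d @ r" "e = r @ b" | r where "d = c @ r" "b = r @ e"
    by (auto simp: append_eq_append_conv2)
  then show ?thesis
  proof cases
    case 1
    with \<open>c' @ b = d' @ e\<close> have "c' = d' @ r" by simp
    with 1 c c' d d' show ?thesis by simp
  next
    case 2
    with \<open>c' @ b = d' @ e\<close> have "d' = c' @ r" by simp
    with 2 c c' d d' show ?thesis by simp
  qed
qed

text \<open>The diagonal entries record the domain, so equality of shapes includes equality of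
  domains.\<close>

definition shape :: "('w \<Rightarrow> 'a list option) \<Rightarrow> 'w \<Rightarrow> 'w \<Rightarrow> ('a list \<times> 'a list) option" where
  "shape h w w' = (case (h w, h w') of (Some x, Some y) \<Rightarrow> Some (strip_common x y) | _ \<Rightarrow> None)"

lemma shape_Some [simp]: "h w = Some x \<Longrightarrow> h w' = Some y \<Longrightarrow> shape h w w' = Some (strip_common x y)"
  by (simp add: shape_def)

lemma shape_None [simp]: "h w = None \<Longrightarrow> shape h w w' = None" "h w' = None \<Longrightarrow> shape h w w' = None"
  by (auto simp: shape_def split: option.splits)

lemma shape_diag_eq_None_iff [simp]: "shape h w w = None \<longleftrightarrow> h w = None"
  by (cases "h w") auto

lemma shape_map_append [simp]: "shape (\<lambda>w. map_option ((@) c) (h w)) = shape h"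
  by (intro ext) (auto simp: shape_def split: option.splits)

lemma shape_comp: "shape (\<lambda>w. h (g w)) w w' = shape h (g w) (g w')"
  by (simp add: shape_def)

section \<open>Longest common prefixes and their relation to shapes\<close>

definition lcp :: "('w \<Rightarrow> 'a list option) \<Rightarrow> 'a list" where
  "lcp h = (if ran h = {} then [] else Longest_common_prefix (ran h))"

lemma prefix_lcp: "h w = Some y \<Longrightarrow> prefix (lcp h) y"
  unfolding lcp_def by (auto intro: Longest_common_prefix_prefix ranI)

lemma append_drop_lcp: "h w = Some y \<Longrightarrow> lcp h @ drop (length (lcp h)) y = y"
  using prefix_lcp by (fastforce simp: prefix_def)

text \<open>Leaving the longest remainder of \<open>y\<close> means sharing the shortest prefix with
  \<open>y\<close>. That shortest shared prefix \<open>c\<close> is then a prefix of every value,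
  hence the longest common one.\<close>

lemma drop_lcp_eq_fst_strip_common:
  assumes "h w = Some y" "h w1 = Some y1"
    and max: "\<And>w2 y2. h w2 = Some y2 \<Longrightarrow>
      length (fst (strip_common y y2)) \<le> length (fst (strip_common y y1))"
  shows "drop (length (lcp h)) y = fst (strip_common y y1)"
proof -
  obtain a b where ab: "strip_common y y1 = (a, b)" by fastforce
  obtain c where c: "y = c @ a" "y1 = c @ b" using ab by (rule strip_commonE)
  have "Longest_common_prefix (ran h) = c"
  proof (rule Longest_common_prefix_eq)
    show "ran h \<noteq> {}" using assms(1) by (auto simp: ran_def)
    show "\<forall>z\<in>ran h. prefix c z"
    proof
      fix z assume "z \<in> ran h"
      then obtain w2 where w2: "h w2 = Some z" by (auto simp: ran_def)
      obtain a2 b2 where ab2: "strip_common y z = (a2, b2)" by fastforce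
      obtain c2 where c2: "y = c2 @ a2" "z = c2 @ b2" using ab2 by (rule strip_commonE)
      have "length a2 \<le> length a" using max[OF w2] ab ab2 by simp
      with c c2 have "length c \<le> length c2"
        by (metis length_append nat_add_left_cancel_le add.commute)
      with c c2 have "prefix c c2" by (metis prefix_length_prefix prefixI)
      with c2 show "prefix c z" by simp
    qed
    show "\<forall>qs. (\<forall>z\<in>ran h. prefix qs z) \<longrightarrow> length qs \<le> length c"
    proof (intro allI impI)
      fix qs assume "\<forall>z\<in>ran h. prefix qs z"
      then have "prefix qs y" "prefix qs y1" using assms by (auto simp: ran_def)
      then obtain s t where st: "y = qs @ s" "y1 = qs @ t" by (auto simp: prefix_def)
      then have "length a \<le> length s" using ab length_fst_strip_common_le[of s t] by simp
      with st c show "length qs \<le> length c"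
        by (metis length_append nat_add_left_cancel_le add.commute)
    qed
  qed
  moreover have "ran h \<noteq> {}" using assms(1) by (auto simp: ran_def)
  ultimately show ?thesis using c ab by (simp add: lcp_def)
qed

text \<open>The partner \<open>w1\<close> whose value leaves the longest remainder of
  \<open>y\<close> can be recognised from the shape alone, so the same \<open>w1\<close> serves for
  \<open>h'\<close>, and both remainders are the same entry of the shape. This lets outputs be
  transported between words with equal residuals.\<close>

lemma shape_eq_drop_lcp:
  assumes eq: "shape h = shape h'" and y: "h w = Some y" "h' w = Some y'"
  shows "drop (length (lcp h)) y = drop (length (lcp h')) y'"
proof -
  \<comment> \<open>All remainders are at most as long as \<open>y\<close>, so the maximum is
    attained even when the range of \<open>h\<close> is infinite.\<close>
  let ?L = "{length (fst (strip_common y y1)) | w1 y1. h w1 = Some y1}"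
  have "?L \<subseteq> {..length y}" using length_fst_strip_common_le by auto
  then have "finite ?L" by (rule finite_subset) simp
  moreover have "?L \<noteq> {}" using y by blast
  ultimately have "Max ?L \<in> ?L" by (rule Max_in)
  then obtain w1 y1 where y1: "h w1 = Some y1" "Max ?L = length (fst (strip_common y y1))"
    by blast
  have max: "length (fst (strip_common y y2)) \<le> length (fst (strip_common y y1))"
    if "h w2 = Some y2" for w2 y2
    unfolding y1(2)[symmetric] using \<open>finite ?L\<close> that by (intro Max_ge) blast+
  have dom: "h v = None \<longleftrightarrow> h' v = None" for v
    using fun_cong[OF fun_cong[OF eq, of v], of v] by (metis shape_diag_eq_None_iff)
  have strip: "strip_common y y2 = strip_common y' y2'" if "h v = Some y2" "h' v = Some y2'" for v y2 y2'
    using fun_cong[OF fun_cong[OF eq, of w], of v] y that by simp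
  obtain y1' where y1': "h' w1 = Some y1'" using dom[of w1] y1(1) by auto
  have "drop (length (lcp h)) y = fst (strip_common y y1)"
    using y(1) y1(1) max by (rule drop_lcp_eq_fst_strip_common)
  also have "\<dots> = fst (strip_common y' y1')" using strip[OF y1(1) y1'] by simp
  also have "\<dots> = drop (length (lcp h')) y'"
    using y(2) y1'
  proof (rule drop_lcp_eq_fst_strip_common[symmetric])
    fix w2 y2' assume y2': "h' w2 = Some y2'"
    then obtain y2 where "h w2 = Some y2" using dom[of w2] by auto
    with max show "length (fst (strip_common y' y2')) \<le> length (fst (strip_common y' y1'))"
      using strip y2' y1(1) y1' by metis
  qed
  finally show ?thesis .
qed

section \<open>Residuals and the syntactic congruence\<close>

definition resid :: "('a list \<Rightarrow> 'b list option) \<Rightarrow> 'a list \<Rightarrow> 'a list \<Rightarrow> 'a list \<Rightarrow> ('b list \<times> 'b list) option" where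
  "resid f u = shape (\<lambda>w. f (u @ w))"

lemma resid_append: "resid f (u @ x) w w' = resid f u (x @ w) (x @ w')"
  by (simp add: resid_def shape_def)

lemma resid_append_cong: "resid f u = resid f v \<Longrightarrow> resid f (u @ x) = resid f (v @ x)"
  by (intro ext) (simp add: resid_append)

text \<open>The left context \<open>u\<close> is unrestricted. When the domain of \<open>f\<close>
  lies in \<open>lists \<Sigma>\<close>, a context outside makes both residuals nowhere defined and
  imposes nothing.\<close>

definition syn_cong :: "'a set \<Rightarrow> ('a list \<Rightarrow> 'b list option) \<Rightarrow> ('a list \<times> 'a list) set" where
  "syn_cong \<Sigma> f = {(x, y). x \<in> lists \<Sigma> \<and> y \<in> lists \<Sigma> \<and> (\<forall>u. resid f (u @ x) = resid f (u @ y))}"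

lemma equiv_syn_cong: "equiv (lists \<Sigma>) (syn_cong \<Sigma> f)"
  by (rule equivI) (auto simp: syn_cong_def refl_on_def sym_def trans_def)

lemma syn_cong_append:
  assumes "(u, v) \<in> syn_cong \<Sigma> f" "(x, y) \<in> syn_cong \<Sigma> f"
  shows "(u @ x, v @ y) \<in> syn_cong \<Sigma> f"
proof -
  have "resid f (w @ u @ x) = resid f (w @ v @ y)" for w
  proof -
    have "resid f ((w @ u) @ x) = resid f ((w @ v) @ x)"
      using assms(1) by (intro resid_append_cong) (simp add: syn_cong_def)
    also have "\<dots> = resid f ((w @ v) @ y)"
      using assms(2) unfolding syn_cong_def by blast
    finally show ?thesis by simp
  qed
  then show ?thesis using assms by (simp add: syn_cong_def)
qed

lemma syn_cong_imp_resid_eq: "(u, v) \<in> syn_cong \<Sigma> f \<Longrightarrow> resid f u = resid f v"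
  unfolding syn_cong_def by (auto dest: spec[of _ "[]"])

section \<open>The syntactic congruence decides V-sequentiality\<close>

text \<open>A recursive form of runs: a path from \<open>p\<close> to \<open>q\<close> on the input
  with output \<open>v\<close>. Unlike state sequences with indexed outputs, it splits directly
  along concatenations of words.\<close>

primrec tr :: "(nat \<times> nat \<times> nat) set \<Rightarrow> (nat \<times> nat \<times> nat \<Rightarrow> nat list) \<Rightarrow>
    nat \<Rightarrow> nat list \<Rightarrow> nat list \<Rightarrow> nat \<Rightarrow> bool" where
  "tr \<Delta> out p [] v q \<longleftrightarrow> v = [] \<and> p = q"
| "tr \<Delta> out p (a # w) v q \<longleftrightarrow>
    (\<exists>p' v'. (p, a, p') \<in> \<Delta> \<and> v = out (p, a, p') @ v' \<and> tr \<Delta> out p' w v' q)"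

lemma run_Nil: "run \<Delta> qs [] \<longleftrightarrow> (\<exists>q. qs = [q])"
  by (auto simp: run_def length_Suc_conv)

lemma run_Cons: "run \<Delta> qs (a # w) \<longleftrightarrow>
    (\<exists>p qs'. qs = p # qs' \<and> (p, a, hd qs') \<in> \<Delta> \<and> run \<Delta> qs' w)"
proof (cases qs)
  case (Cons p qs')
  then show ?thesis
    by (cases qs') (auto simp: run_def less_Suc_eq_0_disj)
qed (simp add: run_def)

lemma run_nonempty: "run \<Delta> qs w \<Longrightarrow> qs \<noteq> []"
  by (auto simp: run_def)

lemma tr_iff_run: "tr \<Delta> out p w v q \<longleftrightarrow>
    (\<exists>qs. run \<Delta> qs w \<and> hd qs = p \<and> last qs = q \<and>
      v = concat (map (\<lambda>j. out (qs ! j, w ! j, qs ! Suc j)) [0..<length w]))"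
proof (induction w arbitrary: p v)
  case Nil
  show ?case by (auto simp: run_Nil)
next
  case (Cons a w)
  have out_Cons: "concat (map (\<lambda>j. out ((p # qs) ! j, (a # w) ! j, (p # qs) ! Suc j)) [0..<length (a # w)])
     = out (p, a, hd qs) @ concat (map (\<lambda>j. out (qs ! j, w ! j, qs ! Suc j)) [0..<length w])"
    if "run \<Delta> qs w" for qs
  proof -
    have "[0..<length (a # w)] = 0 # map Suc [0..<length w]"
      by (simp add: upt_conv_Cons map_Suc_upt del: upt_Suc)
    then show ?thesis
      using run_nonempty[OF that] by (simp only:) (simp add: hd_conv_nth comp_def)
  qed
  show ?case
  proof
    assume "tr \<Delta> out p (a # w) v q"
    then obtain p' v' where p': "(p, a, p') \<in> \<Delta>" "v = out (p, a, p') @ v'" "tr \<Delta> out p' w v' q"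
      by auto
    then obtain qs where qs: "run \<Delta> qs w" "hd qs = p'" "last qs = q"
      "v' = concat (map (\<lambda>j. out (qs ! j, w ! j, qs ! Suc j)) [0..<length w])"
      unfolding Cons.IH by blast
    then have "run \<Delta> (p # qs) (a # w)" "hd (p # qs) = p" "last (p # qs) = q"
      using p' run_nonempty[OF qs(1)] by (auto simp: run_Cons)
    moreover have "v = concat (map (\<lambda>j. out ((p # qs) ! j, (a # w) ! j, (p # qs) ! Suc j)) [0..<length (a # w)])"
      unfolding out_Cons[OF qs(1)] p'(2) qs(2,4)[symmetric] ..
    ultimately show "\<exists>qs. run \<Delta> qs (a # w) \<and> hd qs = p \<and> last qs = q \<and>
        v = concat (map (\<lambda>j. out (qs ! j, (a # w) ! j, qs ! Suc j)) [0..<length (a # w)])"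
      by blast
  next
    assume "\<exists>qs. run \<Delta> qs (a # w) \<and> hd qs = p \<and> last qs = q \<and>
        v = concat (map (\<lambda>j. out (qs ! j, (a # w) ! j, qs ! Suc j)) [0..<length (a # w)])"
    then obtain qs where qs: "(p, a, hd qs) \<in> \<Delta>" "run \<Delta> qs w" "last (p # qs) = q"
      "v = concat (map (\<lambda>j. out ((p # qs) ! j, (a # w) ! j, (p # qs) ! Suc j)) [0..<length (a # w)])"
      unfolding run_Cons by (elim exE conjE) (hypsubst, simp only: list.sel)
    moreover have "tr \<Delta> out (hd qs) w
        (concat (map (\<lambda>j. out (qs ! j, w ! j, qs ! Suc j)) [0..<length w])) q"
      unfolding Cons.IH using qs(2,3) run_nonempty[OF qs(2)] by auto
    ultimately show "tr \<Delta> out p (a # w) v q"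
      unfolding tr.simps out_Cons[OF qs(2)] by blast
  qed
qed

lemma reach_iff_tr: "reach \<Delta> p w q \<longleftrightarrow> (\<exists>v. tr \<Delta> out p w v q)"
  by (auto simp: reach_def tr_iff_run)

lemma realized_iff_tr: "(u, y) \<in> realized \<Delta> I F out i t \<longleftrightarrow>
    (\<exists>p q v. p \<in> I \<and> q \<in> F \<and> tr \<Delta> out p u v q \<and> y = i p @ v @ t q)"
  unfolding realized_def tr_iff_run by auto

lemma tr_append: "tr \<Delta> out p (w @ w') v q \<longleftrightarrow>
    (\<exists>r v1 v2. tr \<Delta> out p w v1 r \<and> tr \<Delta> out r w' v2 q \<and> v = v1 @ v2)"
  by (induction w arbitrary: p v) (simp, fastforce)

lemma tr_unique:
  assumes "deterministic I \<Delta>" "tr \<Delta> out p w v q" "tr \<Delta> out p w v' q'"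
  shows "v = v'" "q = q'"
proof -
  have "tr \<Delta> out p w v q \<Longrightarrow> tr \<Delta> out p w v' q' \<Longrightarrow> v = v' \<and> q = q'" for p v v'
  proof (induction w arbitrary: p v v')
    case (Cons a w)
    then show ?case using assms(1) unfolding deterministic_def tr.simps by metis
  qed simp
  then show "v = v'" "q = q'" using assms(2,3) by auto
qed

lemma tr_lists:
  assumes "\<Delta> \<subseteq> UNIV \<times> \<Sigma> \<times> UNIV" "\<And>d. d \<in> \<Delta> \<Longrightarrow> out d \<in> lists \<Sigma>"
  shows "tr \<Delta> out p w v q \<Longrightarrow> w \<in> lists \<Sigma> \<and> v \<in> lists \<Sigma>"
proof (induction w arbitrary: p v)
  case (Cons a w)
  then obtain p' v' where p': "(p, a, p') \<in> \<Delta>" "v = out (p, a, p') @ v'" "tr \<Delta> out p' w v' q"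
    by auto
  then have "a \<in> \<Sigma>" "out (p, a, p') \<in> lists \<Sigma>" using assms by auto
  with Cons.IH[OF p'(3)] p'(2) show ?case by simp
qed simp

lemma tr_in_states:
  assumes "\<Delta> \<subseteq> Q \<times> \<Sigma> \<times> Q"
  shows "p \<in> Q \<Longrightarrow> tr \<Delta> out p w v q \<Longrightarrow> q \<in> Q"
proof (induction w arbitrary: p v)
  case (Cons a w)
  then show ?case using assms(1) by auto
qed simp

lemma option_eqI: "(\<And>y. a = Some y \<longleftrightarrow> b = Some y) \<Longrightarrow> a = b"
  by (cases a; cases b) auto

definition future :: "(nat \<times> nat \<times> nat) set \<Rightarrow> nat set \<Rightarrow> (nat \<times> nat \<times> nat \<Rightarrow> nat list) \<Rightarrow>
    (nat \<Rightarrow> nat list) \<Rightarrow> nat \<Rightarrow> nat list \<Rightarrow> nat list option" where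
  "future \<Delta> F out t p = transduction_of {(w, v @ t q) | w v q. tr \<Delta> out p w v q \<and> q \<in> F}"

lemma transduction_of_eq_Some_iff:
  assumes "\<And>y y'. (u, y) \<in> R \<Longrightarrow> (u, y') \<in> R \<Longrightarrow> y = y'"
  shows "transduction_of R u = Some y \<longleftrightarrow> (u, y) \<in> R"
proof -
  have "(THE v. (u, v) \<in> R) = v" if "(u, v) \<in> R" for v
    using that by (rule the_equality) (rule assms[OF _ that])
  then show ?thesis
    unfolding transduction_of_def by (metis option.distinct(1) option.inject)
qed

lemma future_eq_Some_iff:
  assumes "deterministic I \<Delta>"
  shows "future \<Delta> F out t p w = Some y \<longleftrightarrow> (\<exists>v q. tr \<Delta> out p w v q \<and> q \<in> F \<and> y = v @ t q)"
proof -
  have "transduction_of {(w, v @ t q) | w v q. tr \<Delta> out p w v q \<and> q \<in> F} w = Some y \<longleftrightarrow>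
      (w, y) \<in> {(w, v @ t q) | w v q. tr \<Delta> out p w v q \<and> q \<in> F}"
    using tr_unique[OF assms] by (intro transduction_of_eq_Some_iff) blast
  then show ?thesis unfolding future_def by blast
qed

section \<open>Transition congruences refine the syntactic congruence\<close>

context
  fixes \<Delta> q0 F out i t f
  assumes det: "deterministic {q0} \<Delta>"
    and f: "\<And>u v. (u, v) \<in> realized \<Delta> {q0} F out i t \<longleftrightarrow> f u = Some v"
begin

text \<open>All values on continuations of \<open>u\<close> start with \<open>i q0 @ c\<close>, and
  shapes ignore this prefix. Hence the residual depends only on the state reached.\<close>

lemma resid_of_tr:
  assumes "tr \<Delta> out q0 u c p"
  shows "resid f u = shape (future \<Delta> F out t p)"
proof -
  have "f (u @ w) = map_option ((@) (i q0 @ c)) (future \<Delta> F out t p w)" for w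
  proof (rule option_eqI)
    fix y
    have "tr \<Delta> out q0 (u @ w) v q \<longleftrightarrow> (\<exists>v2. tr \<Delta> out p w v2 q \<and> v = c @ v2)" for v q
      using assms tr_unique[OF det assms] unfolding tr_append by blast
    then have "f (u @ w) = Some y \<longleftrightarrow>
        (\<exists>z. (\<exists>v q. tr \<Delta> out p w v q \<and> q \<in> F \<and> z = v @ t q) \<and> y = i q0 @ c @ z)"
      unfolding f[symmetric] realized_iff_tr by fastforce
    then show "f (u @ w) = Some y \<longleftrightarrow> map_option ((@) (i q0 @ c)) (future \<Delta> F out t p w) = Some y"
      unfolding future_eq_Some_iff[OF det, symmetric] by auto
  qed
  then show ?thesis by (simp only: resid_def shape_map_append)
qed

lemma resid_of_no_tr:
  assumes "\<nexists>c p. tr \<Delta> out q0 u c p"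
  shows "resid f u = shape (\<lambda>_. None)"
proof -
  have "f (u @ w) = None" for w
    by (rule option_eqI) (use assms in \<open>auto simp: f[symmetric] realized_iff_tr tr_append\<close>)
  then show ?thesis by (simp add: resid_def)
qed

text \<open>The state \<open>p\<close> reached on \<open>u\<close> is unique. From it,
  \<open>x\<close> and \<open>y\<close> either lead to the same state, giving equal residuals by
  \<open>resid_of_tr\<close>, or both have no path, giving the nowhere defined residual.\<close>

lemma trans_cong_subset_syn_cong:
  assumes "\<Delta> \<subseteq> Q \<times> \<Sigma> \<times> Q" "q0 \<in> Q"
  shows "trans_cong \<Sigma> Q \<Delta> \<subseteq> syn_cong \<Sigma> f"
proof safe
  fix x y assume xy: "(x, y) \<in> trans_cong \<Sigma> Q \<Delta>"
  have "resid f (u @ x) = resid f (u @ y)" for u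
  proof (cases "\<exists>c p. tr \<Delta> out q0 u c p")
    case True
    then obtain c p where p: "tr \<Delta> out q0 u c p" by blast
    then have "p \<in> Q" using tr_in_states assms by blast
    then have eq: "(\<exists>v. tr \<Delta> out p x v q) \<longleftrightarrow> (\<exists>v. tr \<Delta> out p y v q)" for q
      using xy tr_in_states[OF assms(1) \<open>p \<in> Q\<close>] unfolding trans_cong_def reach_iff_tr[of _ _ _ _ out]
      by blast
    show ?thesis
    proof (cases "\<exists>v q. tr \<Delta> out p x v q")
      case True
      then obtain v v' q where "tr \<Delta> out p x v q" "tr \<Delta> out p y v' q" using eq by blast
      then have "tr \<Delta> out q0 (u @ x) (c @ v) q" "tr \<Delta> out q0 (u @ y) (c @ v') q"
        using p by (auto simp: tr_append)
      then show ?thesis by (simp add: resid_of_tr)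
    next
      case False
      then have "\<nexists>d q. tr \<Delta> out q0 (u @ x) d q" "\<nexists>d q. tr \<Delta> out q0 (u @ y) d q"
        using eq tr_unique(2)[OF det p] by (auto simp: tr_append)
      then show ?thesis by (simp add: resid_of_no_tr)
    qed
  next
    case False
    then have "\<nexists>d q. tr \<Delta> out q0 (u @ x) d q" "\<nexists>d q. tr \<Delta> out q0 (u @ y) d q"
      by (auto simp: tr_append)
    then show ?thesis by (simp add: resid_of_no_tr)
  qed
  then show "(x, y) \<in> syn_cong \<Sigma> f" using xy by (simp add: syn_cong_def trans_cong_def)
qed

end

text \<open>Closure under coarser congruences asks for finite index of the coarser one, which is
  inherited from the transition congruence refining it.\<close>

lemma syn_cong_in_class:
  assumes "congruence_class V" "finite \<Sigma>" "V_sequential V \<Sigma> f"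
  shows "syn_cong \<Sigma> f \<in> V \<Sigma>"
proof -
  obtain Q \<Delta> I F out i t where T: "is_transducer \<Sigma> Q \<Delta> I F out i t" "deterministic I \<Delta>"
    "trans_cong \<Sigma> Q \<Delta> \<in> V \<Sigma>" "\<And>u v. (u, v) \<in> realized \<Delta> I F out i t \<longleftrightarrow> f u = Some v"
    using assms(3) unfolding V_sequential_def by blast
  obtain q0 where I: "I = {q0}"
    using T(2) by (auto simp: deterministic_def card_1_singleton_iff)
  have sub: "trans_cong \<Sigma> Q \<Delta> \<subseteq> syn_cong \<Sigma> f"
    using T unfolding I is_transducer_def is_automaton_def
    by (intro trans_cong_subset_syn_cong[of q0 \<Delta> F out i t]) auto
  have "fin_index_cong \<Sigma> (trans_cong \<Sigma> Q \<Delta>)"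
    using assms(1,2) T(3) unfolding congruence_class_def by blast
  then have "fin_index_cong \<Sigma> (syn_cong \<Sigma> f)"
    unfolding fin_index_cong_def
    using finite_refines_finite[OF _ sub _ equiv_syn_cong] equiv_syn_cong syn_cong_append by metis
  then show ?thesis using assms(1,2) T(3) sub unfolding congruence_class_def by blast
qed

section \<open>The transducer on residuals with earliest outputs\<close>

lemma lcp_greatest:
  assumes "h w = Some y" "\<And>w y. h w = Some y \<Longrightarrow> prefix c y"
  shows "prefix c (lcp h)"
proof -
  have "ran h \<noteq> {}" using assms(1) by (auto simp: ran_def)
  then show ?thesis
    using assms(2) unfolding lcp_def
    by (auto simp: ran_def intro!: Longest_common_prefix_max_prefix)
qed

lemma resid_eq_dom:
  assumes "resid f u = resid f v"
  shows "f (u @ w) = None \<longleftrightarrow> f (v @ w) = None"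
  using fun_cong[OF fun_cong[OF assms, of w], of w]
  unfolding resid_def by (metis shape_diag_eq_None_iff)

lemma resid_eq_drop_lcp:
  assumes "resid f u = resid f v" "f (u @ w) = Some y" "f (v @ w) = Some y'"
  shows "drop (length (lcp (\<lambda>w. f (u @ w)))) y = drop (length (lcp (\<lambda>w. f (v @ w)))) y'"
  using assms unfolding resid_def by (intro shape_eq_drop_lcp)

lemma finite_resid_image:
  assumes "finite (lists \<Sigma> // syn_cong \<Sigma> f)"
  shows "finite (resid f ` lists \<Sigma>)"
proof -
  have "resid f ` lists \<Sigma> \<subseteq> (\<lambda>C. resid f (SOME u. u \<in> C)) ` (lists \<Sigma> // syn_cong \<Sigma> f)"
  proof
    fix \<rho> assume "\<rho> \<in> resid f ` lists \<Sigma>"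
    then obtain u where u: "u \<in> lists \<Sigma>" "\<rho> = resid f u" by blast
    then have "u \<in> syn_cong \<Sigma> f `` {u}" by (simp add: syn_cong_def)
    then have "(u, SOME v. v \<in> syn_cong \<Sigma> f `` {u}) \<in> syn_cong \<Sigma> f"
      by (metis Image_singleton_iff someI)
    then have "\<rho> = resid f (SOME v. v \<in> syn_cong \<Sigma> f `` {u})"
      using u(2) syn_cong_imp_resid_eq by metis
    then show "\<rho> \<in> (\<lambda>C. resid f (SOME u. u \<in> C)) ` (lists \<Sigma> // syn_cong \<Sigma> f)"
      using quotientI[OF u(1)] by (rule image_eqI)
  qed
  then show ?thesis using assms by (rule finite_surj[rotated])
qed

text \<open>The constructed transducer has, after reading any \<open>u\<close> that extends into the
  domain, produced exactly \<open>L u\<close>, the longest prefix common to all values still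
  possible. Its states are the residuals, so its transition congruence is the syntactic one.\<close>

lemma V_sequential_if_syn_cong:
  assumes fin: "finite (lists \<Sigma> // syn_cong \<Sigma> f)"
    and V: "syn_cong \<Sigma> f \<in> V \<Sigma>"
    and f: "\<And>u y. f u = Some y \<Longrightarrow> u \<in> lists \<Sigma> \<and> y \<in> lists \<Sigma>"
  shows "V_sequential V \<Sigma> f"
proof -
  \<comment> \<open>Residuals are functions while states must be naturals, so the finitely many
    residuals are numbered.\<close>
  obtain h :: "_ \<Rightarrow> nat" where h: "inj_on h (resid f ` lists \<Sigma>)"
    using finite_imp_inj_to_nat_seg[OF finite_resid_image[OF fin]] by blast
  define st where "st u = h (resid f u)" for u
  have st_eq: "st u = st v \<longleftrightarrow> resid f u = resid f v" if "u \<in> lists \<Sigma>" "v \<in> lists \<Sigma>" for u v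
    using inj_on_eq_iff[OF h] that by (simp add: st_def)
  have st_append: "st (u @ x) = st (v @ x)" if "u \<in> lists \<Sigma>" "v \<in> lists \<Sigma>" "st u = st v" for u v x
    using resid_append_cong[of f u v x] st_eq[OF that(1,2)] that(3) by (simp add: st_def)
  \<comment> \<open>Outputs are read off one chosen word per state; \<open>L_out\<close> and
    \<open>L_t\<close> show that they suit every word reaching the state.\<close>
  define rep where "rep p = (SOME u. u \<in> lists \<Sigma> \<and> st u = p)" for p
  have rep: "rep (st u) \<in> lists \<Sigma>" "resid f (rep (st u)) = resid f u" if u: "u \<in> lists \<Sigma>" for u
  proof -
    have "rep (st u) \<in> lists \<Sigma> \<and> st (rep (st u)) = st u"
      unfolding rep_def using u by (intro someI_ex[of "\<lambda>v. v \<in> lists \<Sigma> \<and> st v = st u"]) blast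
    then show "rep (st u) \<in> lists \<Sigma>" "resid f (rep (st u)) = resid f u"
      using st_eq u by auto
  qed
  define L where "L u = lcp (\<lambda>w. f (u @ w))" for u
  have L_lists: "L u \<in> lists \<Sigma>" for u
  proof (cases "\<exists>w y. f (u @ w) = Some y")
    case True
    then obtain w y where y: "f (u @ w) = Some y" by blast
    then have "prefix (L u) y" unfolding L_def by (rule prefix_lcp)
    with f[OF y] show ?thesis by (auto simp: prefix_def)
  next
    case False
    \<comment> \<open>Here the default value of \<open>lcp\<close> is used: on dead words
      \<open>L u\<close> is empty, so outputs stay words over the alphabet.\<close>
    then have "ran (\<lambda>w. f (u @ w)) = {}" by (auto simp: ran_def)
    then show ?thesis by (simp add: L_def lcp_def)
  qed
  have L_eq: "L u @ drop (length (L u)) y = y" if "f (u @ w) = Some y" for u w y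
    unfolding L_def using append_drop_lcp[where h = "\<lambda>w. f (u @ w)"] that by blast
  have L_step: "prefix (L u) (L (u @ [a]))" if "f (u @ a # w) = Some y" for u a w y
    unfolding L_def using that by (intro lcp_greatest[where w = w]) (auto intro: prefix_lcp)
  \<comment> \<open>The nowhere defined residual is kept as a state if it occurs. Thus every letter
    of \<Sigma> has a transition from every state, and each word over \<Sigma> acts on
    \<open>Q\<close> as a function.\<close>
  define Q where "Q = st ` lists \<Sigma>"
  define \<Delta> where "\<Delta> = {(st u, a, st (u @ [a])) | u a. u \<in> lists \<Sigma> \<and> a \<in> \<Sigma>}"
  define F where "F = {st u | u. u \<in> lists \<Sigma> \<and> f u \<noteq> None}"
  define out where
    "out = (\<lambda>(p, a, q :: nat). drop (length (L (rep p))) (L (rep p @ [a])))"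
  define t where "t p = drop (length (L (rep p))) (the (f (rep p)))" for p
  \<comment> \<open>A continuation into the domain is required: if \<open>u @ [a]\<close> is dead,
    \<open>L (u @ [a])\<close> is the empty default and need not extend \<open>L u\<close>.\<close>
  have L_out: "L u @ out (st u, a, q) = L (u @ [a])"
    if u: "u \<in> lists \<Sigma>" and y: "f (u @ a # w) = Some y" for u a w y q
  proof -
    define v where "v = rep (st u)"
    have v: "resid f v = resid f u" using rep(2)[OF u] by (simp add: v_def)
    then obtain y' where y': "f (v @ a # w) = Some y'"
      using resid_eq_dom[OF v] y by (metis not_None_eq)
    obtain x x' where x: "L (u @ [a]) = L u @ x" "L (v @ [a]) = L v @ x'"
      using L_step[OF y] L_step[OF y'] by (auto simp: prefix_def)
    have "y = L u @ x @ drop (length (L (u @ [a]))) y" "y' = L v @ x' @ drop (length (L (v @ [a]))) y'"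
      using L_eq[of "u @ [a]" w y] L_eq[of "v @ [a]" w y'] y y' x by simp_all
    moreover have "drop (length (L u)) y = drop (length (L v)) y'"
      unfolding L_def using v[symmetric] y y' by (rule resid_eq_drop_lcp)
    moreover have "drop (length (L (u @ [a]))) y = drop (length (L (v @ [a]))) y'"
      unfolding L_def using resid_append_cong[OF v[symmetric]] y y'
      by (intro resid_eq_drop_lcp[where w = w]) simp_all
    \<comment> \<open>Both \<open>x\<close> and \<open>x'\<close>, followed by the same suffix, give
      the same word; cancelling the suffix identifies them.\<close>
    ultimately have "x = x'" by (metis append_eq_conv_conj append_same_eq)
    then show ?thesis using x by (simp add: out_def v_def[symmetric])
  qed
  have L_t: "L u @ t (st u) = y" if u: "u \<in> lists \<Sigma>" and y: "f u = Some y" for u y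
  proof -
    define v where "v = rep (st u)"
    have v: "resid f v = resid f u" using rep(2)[OF u] by (simp add: v_def)
    then obtain y' where y': "f v = Some y'"
      using resid_eq_dom[OF v, of "[]"] y by auto
    have "drop (length (L u)) y = drop (length (L v)) y'"
      unfolding L_def using v[symmetric] y y' by (intro resid_eq_drop_lcp[where w = "[]"]) simp_all
    then show ?thesis using L_eq[of u "[]" y] y y' by (simp add: t_def v_def[symmetric])
  qed
  have det: "deterministic {st []} \<Delta>"
    unfolding deterministic_def \<Delta>_def using st_append by auto
  have \<Delta>_sub: "\<Delta> \<subseteq> Q \<times> \<Sigma> \<times> Q" unfolding \<Delta>_def Q_def by (auto intro!: imageI)
  have out_lists: "out d \<in> lists \<Sigma>" for d
    using L_lists[of "rep (fst d) @ [fst (snd d)]"]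
    by (auto simp: out_def split: prod.split dest: in_set_dropD)
  have t_lists: "t q \<in> lists \<Sigma>" if "q \<in> F" for q
  proof -
    obtain u where u: "u \<in> lists \<Sigma>" "f u \<noteq> None" "q = st u" using \<open>q \<in> F\<close> unfolding F_def by blast
    then obtain y where y: "f u = Some y" by blast
    show ?thesis using L_t[OF u(1) y] f[OF y] unfolding u(3) by auto
  qed
  have tr_ex: "\<exists>v. tr \<Delta> out (st u) x v (st (u @ x))" if "u \<in> lists \<Sigma>" "x \<in> lists \<Sigma>" for u x
    using that
  proof (induction x arbitrary: u)
    case (Cons a x)
    then have "(st u, a, st (u @ [a])) \<in> \<Delta>" unfolding \<Delta>_def by auto
    moreover obtain v where "tr \<Delta> out (st (u @ [a])) x v (st ((u @ [a]) @ x))"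
      using Cons.IH[of "u @ [a]"] Cons.prems by auto
    ultimately show ?case by auto
  qed simp
  have tr_state: "x \<in> lists \<Sigma> \<and> q = st (u @ x)" if "u \<in> lists \<Sigma>" "tr \<Delta> out (st u) x v q" for u x v q
  proof -
    have "x \<in> lists \<Sigma>" using tr_lists[OF _ out_lists that(2)] \<Delta>_sub by blast
    then show ?thesis using tr_ex[OF that(1)] tr_unique(2)[OF det that(2)] by blast
  qed
  \<comment> \<open>The outputs telescope by \<open>L_out\<close>. The completion \<open>w\<close>
    is generalised, since removing the last letter \<open>a\<close> from \<open>x\<close> turns it
    into \<open>a # w\<close>.\<close>
  have tr_L: "L [] @ v = L x" if "tr \<Delta> out (st []) x v q" "f (x @ w) = Some y" for x v q w y
    using that
  proof (induction x arbitrary: v q w rule: rev_induct)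
    case (snoc a x)
    then obtain v1 r v2 where r: "tr \<Delta> out (st []) x v1 r" "tr \<Delta> out r [a] v2 q" "v = v1 @ v2"
      unfolding tr_append by blast
    have "x \<in> lists \<Sigma> \<and> r = st x" using tr_state[OF _ r(1)] by simp
    moreover have "L [] @ v1 = L x" using snoc r by simp
    moreover have "v = v1 @ out (r, a, q)" using r by auto
    moreover have "f (x @ a # w) = Some y" using snoc.prems(2) by simp
    ultimately show ?case using L_out[of x a w y q] by (metis append_assoc)
  qed simp
  have realized: "(u, y) \<in> realized \<Delta> {st []} F out (\<lambda>_. L []) t \<longleftrightarrow> f u = Some y" for u y
  proof
    assume "(u, y) \<in> realized \<Delta> {st []} F out (\<lambda>_. L []) t"
    then obtain q v where q: "q \<in> F" "tr \<Delta> out (st []) u v q" "y = L [] @ v @ t q"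
      unfolding realized_iff_tr by blast
    have u: "u \<in> lists \<Sigma>" "q = st u" using tr_state[OF _ q(2)] by simp_all
    \<comment> \<open>Finality is witnessed by some word \<open>u'\<close>, possibly different from
      \<open>u\<close>; equal residuals agree on whether the empty continuation is defined.\<close>
    obtain u' where u': "u' \<in> lists \<Sigma>" "f u' \<noteq> None" "q = st u'" using q(1) F_def by auto
    then have "resid f u = resid f u'" using st_eq u by simp
    then obtain z where z: "f u = Some z"
      using resid_eq_dom[of f u u' "[]"] u'(2) by auto
    have "y = z" using tr_L[OF q(2), of "[]" z] z L_t[OF u(1) z] q(3) u(2) by (metis append_assoc append_Nil2)
    then show "f u = Some y" using z by simp
  next
    assume y: "f u = Some y"
    then have u: "u \<in> lists \<Sigma>" using f by blast
    obtain v where v: "tr \<Delta> out (st []) u v (st u)" using tr_ex[of "[]" u] u by auto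
    have "y = L [] @ v @ t (st u)" using tr_L[OF v, of "[]" y] y L_t[OF u y] by (metis append_assoc append_Nil2)
    moreover have "st u \<in> F" using u y unfolding F_def by blast
    ultimately show "(u, y) \<in> realized \<Delta> {st []} F out (\<lambda>_. L []) t"
      unfolding realized_iff_tr using v by blast
  qed
  have reach: "reach \<Delta> (st u) x q \<longleftrightarrow> q = st (u @ x)"
    if "u \<in> lists \<Sigma>" "x \<in> lists \<Sigma>" for u x q
    unfolding reach_iff_tr[of _ _ _ _ out] using tr_ex[OF that] tr_state[OF that(1)] by blast
  have dead: "resid f (u @ x) = shape (\<lambda>_. None)" if "u \<notin> lists \<Sigma>" for u x
  proof -
    have "f (u @ x @ w) = None" for w
      using f[of "u @ x @ w"] that by (cases "f (u @ x @ w)") auto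
    then show ?thesis by (simp add: resid_def)
  qed
  have "(\<forall>p\<in>Q. \<forall>q\<in>Q. reach \<Delta> p x q \<longleftrightarrow> reach \<Delta> p y q) \<longleftrightarrow>
      (\<forall>u. resid f (u @ x) = resid f (u @ y))" if xy: "x \<in> lists \<Sigma>" "y \<in> lists \<Sigma>" for x y
  proof -
    have append: "u @ x \<in> lists \<Sigma>" "u @ y \<in> lists \<Sigma>" if "u \<in> lists \<Sigma>" for u
      using that xy by simp_all
    have "(\<forall>p\<in>Q. \<forall>q\<in>Q. reach \<Delta> p x q \<longleftrightarrow> reach \<Delta> p y q) \<longleftrightarrow>
        (\<forall>u\<in>lists \<Sigma>. st (u @ x) = st (u @ y))"
    proof (rule iffI; rule ballI)
      fix u assume *: "\<forall>p\<in>Q. \<forall>q\<in>Q. reach \<Delta> p x q \<longleftrightarrow> reach \<Delta> p y q" and u: "u \<in> lists \<Sigma>"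
      have "st u \<in> Q" "st (u @ x) \<in> Q" using u append by (auto simp: Q_def intro!: imageI)
      then have "reach \<Delta> (st u) y (st (u @ x))" using * reach[OF u xy(1)] by blast
      then show "st (u @ x) = st (u @ y)" using reach[OF u xy(2)] by blast
    next
      fix p assume *: "\<forall>u\<in>lists \<Sigma>. st (u @ x) = st (u @ y)" and "p \<in> Q"
      then obtain u where u: "u \<in> lists \<Sigma>" "p = st u" unfolding Q_def by blast
      then show "\<forall>q\<in>Q. reach \<Delta> p x q \<longleftrightarrow> reach \<Delta> p y q"
        using * reach[OF u(1) xy(1)] reach[OF u(1) xy(2)] by metis
    qed
    also have "\<dots> \<longleftrightarrow> (\<forall>u\<in>lists \<Sigma>. resid f (u @ x) = resid f (u @ y))"
      by (intro ball_cong refl st_eq append)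
    also have "\<dots> \<longleftrightarrow> (\<forall>u. resid f (u @ x) = resid f (u @ y))"
      using dead by metis
    finally show ?thesis .
  qed
  then have "trans_cong \<Sigma> Q \<Delta> = syn_cong \<Sigma> f"
    unfolding trans_cong_def syn_cong_def by blast
  then have "trans_cong \<Sigma> Q \<Delta> \<in> V \<Sigma>" using V by simp
  moreover have "is_transducer \<Sigma> Q \<Delta> {st []} F out (\<lambda>_. L []) t"
  proof -
    have "finite Q"
      using finite_imageI[OF finite_resid_image[OF fin], of h] by (simp add: Q_def st_def image_image)
    then show ?thesis
      unfolding is_transducer_def is_automaton_def
      using \<Delta>_sub out_lists t_lists L_lists by (auto simp: Q_def F_def)
  qed
  ultimately show ?thesis unfolding V_sequential_def using det realized by blast
qed

lemma V_sequential_iff_syn_cong: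
  assumes "congruence_class V" "finite \<Sigma>"
    and "\<And>u y. f u = Some y \<Longrightarrow> u \<in> lists \<Sigma> \<and> y \<in> lists \<Sigma>"
  shows "V_sequential V \<Sigma> f \<longleftrightarrow> syn_cong \<Sigma> f \<in> V \<Sigma>"
proof
  assume "syn_cong \<Sigma> f \<in> V \<Sigma>"
  moreover have "finite (lists \<Sigma> // syn_cong \<Sigma> f)"
    using calculation assms(1,2) unfolding congruence_class_def fin_index_cong_def by blast
  ultimately show "V_sequential V \<Sigma> f" using assms(3) by (intro V_sequential_if_syn_cong)
qed (rule syn_cong_in_class[OF assms(1,2)])

section \<open>Finite certificates for the syntactic congruence\<close>

definition agree :: "'w set \<Rightarrow> ('w \<Rightarrow> 'a list option) \<Rightarrow> ('w \<Rightarrow> 'a list option) \<Rightarrow> bool" where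
  "agree W h h' \<longleftrightarrow> (\<forall>w\<in>W. \<forall>w'\<in>W. shape h w w' = shape h' w w')"

lemma agree_mono: "agree W h h' \<Longrightarrow> W' \<subseteq> W \<Longrightarrow> agree W' h h'"
  unfolding agree_def by blast

lemma agree_cong:
  "shape g = shape h \<Longrightarrow> shape g' = shape h' \<Longrightarrow> agree W g g' \<longleftrightarrow> agree W h h'"
  by (simp add: agree_def)

lemma agree_dom: "agree W h h' \<Longrightarrow> w \<in> W \<Longrightarrow> h w = None \<longleftrightarrow> h' w = None"
  unfolding agree_def by (metis shape_diag_eq_None_iff)

text \<open>This lifts \<open>strip_common_trans\<close> to shapes. The middle argument must be
  defined, since otherwise both assumptions would compare only \<open>None\<close> entries.\<close>

lemma shape_trans:
  assumes "shape h u v = shape h' u v" "shape h v w = shape h' v w"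
    and "h v \<noteq> None" "h' v \<noteq> None"
  shows "shape h u w = shape h' u w"
proof (cases "h u = None \<or> h w = None")
  case True
  then have "h' u = None \<or> h' w = None"
    using assms by (auto simp: shape_def split: option.splits)
  with True show ?thesis by auto
next
  case False
  then obtain x y z where h: "h u = Some x" "h v = Some y" "h w = Some z"
    using assms(3) by auto
  then obtain x' y' z' where h': "h' u = Some x'" "h' v = Some y'" "h' w = Some z'"
    using assms by (auto simp: shape_def split: option.splits)
  from h h' assms(1,2) strip_common_trans[of x y x' y' z z'] show ?thesis by simp
qed

text \<open>The empty word is added to start the induction on length in
  \<open>agree_imp_shape_eq\<close>.\<close>

definition extend :: "'a set \<Rightarrow> 'a list set \<Rightarrow> 'a list set" where
  "extend \<Sigma> W = insert [] (W \<union> (\<Union>a\<in>\<Sigma>. (#) a ` W))"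

text \<open>A longer test word is compared through an anchor, a test word with the same first letter
  on which the function is defined as well.\<close>

lemma agree_imp_shape_eq:
  fixes K :: "('c list \<Rightarrow> 'a list option) set"
  assumes empty: "(\<lambda>_. None) \<in> K"
    and closed: "\<And>h a. h \<in> K \<Longrightarrow> a \<in> \<Sigma> \<Longrightarrow> \<exists>h'\<in>K. shape h' = shape (\<lambda>w. h (a # w))"
    and off: "\<And>h a w. h \<in> K \<Longrightarrow> a \<notin> \<Sigma> \<Longrightarrow> h (a # w) = None"
    and stable: "\<And>h h'. h \<in> K \<Longrightarrow> h' \<in> K \<Longrightarrow> agree W h h' \<Longrightarrow> agree (extend \<Sigma> W) h h'"
    and h: "h \<in> K" "h' \<in> K" "agree W h h'"
  shows "shape h = shape h'"
proof -
  \<comment> \<open>\<open>W\<close> stays inside every \<open>B k\<close>, so that the induction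
    hypothesis also compares words with anchors taken from \<open>W\<close>, whatever their
    length.\<close>
  define B where "B k = W \<union> {w. length w \<le> k}" for k
  have B: "agree (B k) h h'" if "h \<in> K" "h' \<in> K" "agree W h h'" for k h h'
    using that
  proof (induction k arbitrary: h h')
    case 0
    then have "agree (extend \<Sigma> W) h h'" by (rule stable)
    then show ?case by (rule agree_mono) (auto simp: B_def extend_def)
  next
    case (Suc k)
    have ext: "agree (extend \<Sigma> W) h h'" using Suc.prems by (rule stable)
    have letter: "shape h (a # w) (a # w') = shape h' (a # w) (a # w')"
      if a: "a \<in> \<Sigma>" and w: "w \<in> B k" "w' \<in> B k" for a w w'
    proof -
      obtain ha ha' where ha: "ha \<in> K" "shape ha = shape (\<lambda>w. h (a # w))"
        "ha' \<in> K" "shape ha' = shape (\<lambda>w. h' (a # w))"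
        using closed Suc.prems(1,2) a by meson
      have "agree W (\<lambda>w. h (a # w)) (\<lambda>w. h' (a # w))"
        using ext a unfolding agree_def shape_comp extend_def by blast
      then have "agree W ha ha'" using agree_cong[OF ha(2,4)] by blast
      then have "agree (B k) ha ha'" using Suc.IH ha by blast
      then have "agree (B k) (\<lambda>w. h (a # w)) (\<lambda>w. h' (a # w))"
        using agree_cong[OF ha(2,4)] by blast
      then show ?thesis using w unfolding agree_def shape_comp by blast
    qed
    have anchor: "\<exists>w0\<in>W. h (a # w0) \<noteq> None"
      if a: "a \<in> \<Sigma>" and w: "w \<in> B k" "h (a # w) \<noteq> None" for a w
    proof (rule ccontr)
      assume no: "\<not> (\<exists>w0\<in>W. h (a # w0) \<noteq> None)"
      obtain ha where ha: "ha \<in> K" "shape ha = shape (\<lambda>w. h (a # w))"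
        using closed Suc.prems(1) a by meson
      \<comment> \<open>Without an anchor, the residual by \<open>a\<close> looks nowhere defined on
        \<open>W\<close>. Since the nowhere defined function belongs to \<open>K\<close>, the
        induction hypothesis makes the residual undefined on all of \<open>B k\<close>, against the
        choice of \<open>w\<close>.\<close>
      have "agree W (\<lambda>w. h (a # w)) (\<lambda>_. None)"
        using no by (auto simp: agree_def)
      then have "agree W ha (\<lambda>_. None)" using agree_cong[OF ha(2) refl] by blast
      then have "agree (B k) ha (\<lambda>_. None)" using Suc.IH ha(1) empty by blast
      then have "agree (B k) (\<lambda>w. h (a # w)) (\<lambda>_. None)" using agree_cong[OF ha(2) refl] by blast
      from agree_dom[OF this w(1)] w(2) show False by simp
    qed
    have reduce: "h v = None \<and> h' v = None \<or>
        (\<exists>v0\<in>extend \<Sigma> W. h v0 \<noteq> None \<and> h' v0 \<noteq> None \<and>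
          shape h v v0 = shape h' v v0 \<and> shape h v0 v = shape h' v0 v)"
      if v: "v \<in> B (Suc k)" for v
    proof (cases "v \<in> extend \<Sigma> W")
      case True
      with agree_dom[OF ext True] ext show ?thesis unfolding agree_def by blast
    next
      case False
      then obtain a w where aw: "v = a # w" "w \<in> B k"
        using v unfolding B_def extend_def by (cases v) auto
      show ?thesis
      proof (cases "a \<in> \<Sigma>")
        case a: True
        have dom: "h v = None \<longleftrightarrow> h' v = None"
          using letter[OF a aw(2) aw(2)] unfolding aw(1) by (metis shape_diag_eq_None_iff)
        show ?thesis
        proof (cases "h v = None")
          case True
          with dom show ?thesis by simp
        next
          case False
          then obtain w0 where w0: "w0 \<in> W" "h (a # w0) \<noteq> None"
            using anchor[OF a aw(2)] aw(1) by blast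
          then have mem: "a # w0 \<in> extend \<Sigma> W" "w0 \<in> B k"
            using a by (auto simp: extend_def B_def)
          then show ?thesis
            using letter[OF a aw(2) mem(2)] letter[OF a mem(2) aw(2)] w0(2)
              agree_dom[OF ext mem(1)] unfolding aw(1)
            by (intro disjI2 bexI[OF _ mem(1)]) simp
        qed
      next
        case False
        then show ?thesis using off[OF Suc.prems(1)] off[OF Suc.prems(2)] aw(1) by simp
      qed
    qed
    \<comment> \<open>The words \<open>v\<close> and \<open>v'\<close> are joined by the chain v,
      v0, v0', v': the outer links come from \<open>reduce\<close>, the middle one lies in the
      extended test set, and \<open>shape_trans\<close> composes them.\<close>
    show ?case unfolding agree_def
    proof (intro ballI)
      fix v v' assume v: "v \<in> B (Suc k)" "v' \<in> B (Suc k)"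
      from reduce[OF v(1)] show "shape h v v' = shape h' v v'"
      proof (elim disjE bexE conjE)
        fix v0 assume v0: "v0 \<in> extend \<Sigma> W" "h v0 \<noteq> None" "h' v0 \<noteq> None"
          "shape h v v0 = shape h' v v0"
        from reduce[OF v(2)] show ?thesis
        proof (elim disjE bexE conjE)
          fix v0' assume v0': "v0' \<in> extend \<Sigma> W" "h v0' \<noteq> None" "h' v0' \<noteq> None"
            "shape h v0' v' = shape h' v0' v'"
          have "shape h v0 v0' = shape h' v0 v0'"
            using ext v0(1) v0'(1) unfolding agree_def by blast
          then have "shape h v0 v' = shape h' v0 v'"
            using v0'(4,2,3) by (rule shape_trans)
          with v0(4) show ?thesis using v0(2,3) by (rule shape_trans)
        qed simp
      qed simp
    qed
  qed
  show ?thesis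
  proof (intro ext)
    fix w w'
    show "shape h w w' = shape h' w w'"
      using B[OF h, of "max (length w) (length w')"] unfolding agree_def B_def by auto
  qed
qed

text \<open>One pair of arguments witnesses each difference of shapes, and finitely many functions
  have finitely many differences.\<close>

lemma finite_separating_set:
  assumes "finite K"
  obtains W :: "'c list set" where "finite W"
    "\<And>h h'. h \<in> K \<Longrightarrow> h' \<in> K \<Longrightarrow> agree W h h' \<Longrightarrow> shape h = shape h'"
proof -
  have "\<exists>w w'. shape h w w' \<noteq> shape h' w w'" if "shape h \<noteq> shape h'" for h h' :: "'c list \<Rightarrow> 'a list option"
    using that by (metis ext)
  then obtain s s' where s: "shape h (s h h') (s' h h') \<noteq> shape h' (s h h') (s' h h')"
    if "shape h \<noteq> shape h'" for h h' :: "'c list \<Rightarrow> 'a list option"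
    by metis
  show thesis
  proof
    show "finite (\<Union>h\<in>K. \<Union>h'\<in>K. {s h h', s' h h'})" using assms by simp
    fix h h' assume "h \<in> K" "h' \<in> K" "agree (\<Union>h\<in>K. \<Union>h'\<in>K. {s h h', s' h h'}) h h'"
    then have "shape h (s h h') (s' h h') = shape h' (s h h') (s' h h')"
      unfolding agree_def by blast
    then show "shape h = shape h'" using s by blast
  qed
qed

text \<open>A word acts on the finite set of residuals by right extension, and its class consists of
  the words with the same action. The action is recorded by its graph \<open>act x\<close>, a subset
  of a finite product.\<close>

lemma finite_quotient_syn_cong:
  assumes "finite (range (resid f))"
  shows "finite (lists \<Sigma> // syn_cong \<Sigma> f)"
proof -
  define act where "act x = (\<lambda>u. (resid f u, resid f (u @ x))) ` UNIV" for x
  have eq: "resid f (u @ x) = resid f (u @ y)" if "act x = act y" for u x y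
  proof -
    have "(resid f u, resid f (u @ x)) \<in> act y" using that by (auto simp: act_def)
    then obtain v where "resid f u = resid f v" "resid f (u @ x) = resid f (v @ y)"
      unfolding act_def by blast
    then show ?thesis using resid_append_cong by metis
  qed
  have "lists \<Sigma> // syn_cong \<Sigma> f \<subseteq> (\<lambda>A. {y \<in> lists \<Sigma>. act y = A}) ` Pow (range (resid f) \<times> range (resid f))"
  proof
    fix C assume "C \<in> lists \<Sigma> // syn_cong \<Sigma> f"
    then obtain x where x: "x \<in> lists \<Sigma>" "C = syn_cong \<Sigma> f `` {x}" by (rule quotientE)
    have "act y = act x \<longleftrightarrow> (\<forall>u. resid f (u @ x) = resid f (u @ y))" for y
    proof
      assume "act y = act x"
      then show "\<forall>u. resid f (u @ x) = resid f (u @ y)" using eq by metis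
    qed (simp add: act_def)
    then have "C = {y \<in> lists \<Sigma>. act y = act x}"
      using x(1) unfolding x(2) syn_cong_def by blast
    moreover have "act x \<in> Pow (range (resid f) \<times> range (resid f))" by (auto simp: act_def)
    ultimately show "C \<in> (\<lambda>A. {y \<in> lists \<Sigma>. act y = A}) ` Pow (range (resid f) \<times> range (resid f))"
      by blast
  qed
  then show ?thesis by (rule finite_subset) (simp add: assms)
qed

section \<open>Representatives and the monoid they present\<close>

definition class_index :: "('a list \<Rightarrow> 'a list \<Rightarrow> bool) \<Rightarrow> 'a list list \<Rightarrow> 'a list \<Rightarrow> nat" where
  "class_index E Z x = length (takeWhile (\<lambda>z. \<not> E z x) Z)"

text \<open>\<open>class_index\<close> returns \<open>length Z\<close> when no entry is equivalent,
  so the two inequalities say that products and letters are represented. The last equation says that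
  each entry is its own first representative, that is, no class is listed twice.\<close>

definition transversal :: "('a list \<Rightarrow> 'a list \<Rightarrow> bool) \<Rightarrow> 'a list list \<Rightarrow> 'a list \<Rightarrow> bool" where
  "transversal E Z sig \<longleftrightarrow>
     (\<forall>x\<in>set Z. \<forall>y\<in>set Z. class_index E Z (x @ y) < length Z) \<and>
     (\<forall>a\<in>set sig. class_index E Z [a] < length Z) \<and>
     map (class_index E Z) Z = [0..<length Z]"

definition table :: "('a list \<Rightarrow> 'a list \<Rightarrow> bool) \<Rightarrow> 'a list list \<Rightarrow> nat list list" where
  "table E Z = map (\<lambda>x. map (\<lambda>y. class_index E Z (x @ y)) Z) Z"

definition letter_images :: "('a list \<Rightarrow> 'a list \<Rightarrow> bool) \<Rightarrow> 'a list list \<Rightarrow> 'a list \<Rightarrow> nat list" where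
  "letter_images E Z sig = map (\<lambda>a. class_index E Z [a]) sig"

lemma class_index_less: "class_index E Z x < length Z \<Longrightarrow> E (Z ! class_index E Z x) x"
  unfolding class_index_def using nth_length_takeWhile by blast

lemma class_index_less_iff: "class_index E Z x < length Z \<longleftrightarrow> (\<exists>z\<in>set Z. E z x)"
proof
  assume "\<exists>z\<in>set Z. E z x"
  then have "takeWhile (\<lambda>z. \<not> E z x) Z \<noteq> Z" using takeWhile_eq_all_conv by metis
  then show "class_index E Z x < length Z"
    unfolding class_index_def
    by (metis le_neq_implies_less length_takeWhile_le takeWhile_eq_take take_all_iff order_refl)
qed (metis class_index_less nth_mem)

text \<open>\<open>E\<close> tests only the contexts in \<open>Z\<close>. Closure of
  \<open>Z\<close> under products and letters up to \<open>E\<close> shows that these contexts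
  already realise all residuals of words over \<open>sig\<close>, so \<open>E\<close> coincides with
  equality in all contexts and multiplication of representatives is well defined.\<close>

lemma presentation_correct:
  fixes f :: "nat list \<Rightarrow> 'b list option"
  assumes E: "\<And>x y. E x y \<longleftrightarrow> (\<forall>z\<in>set Z. resid f (z @ x) = resid f (z @ y))"
    and Z: "Z = [] # Z'"
    and tv: "transversal E Z sig"
    and sig: "distinct sig"
    and dom: "\<And>u. f u \<noteq> None \<Longrightarrow> u \<in> lists (set sig)"
  shows "valid_pres sig (length Z) (table E Z) 0 (letter_images E Z sig)"
    and "pres_cong sig (table E Z) 0 (letter_images E Z sig) = syn_cong (set sig) f"
proof -
  let ?m = "length Z" and ?ci = "class_index E Z" and ?tab = "table E Z" and ?img = "letter_images E Z sig"
  have ci: "E (Z ! ?ci x) x" if "?ci x < ?m" for x using class_index_less[OF that] .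
  have ci_eq: "?ci x = ?ci y" if "E x y" for x y
  proof -
    have "E z x \<longleftrightarrow> E z y" for z using that unfolding E by auto
    then show ?thesis by (simp add: class_index_def)
  qed
  have ci_nth: "?ci (Z ! i) = i" if "i < ?m" for i
    using tv that unfolding transversal_def by (metis add_0 nth_map nth_upt)
  have E_refl: "E x x" and E_sym: "E x y \<Longrightarrow> E y x" and E_trans: "E x y \<Longrightarrow> E y w \<Longrightarrow> E x w"
    for x y w unfolding E by auto
  have E_right: "E (x @ v) (y @ v)" if "E x y" for x y v
    using that resid_append_cong unfolding E append_assoc[symmetric] by blast
  have E_resid: "resid f x = resid f y" if "E x y" for x y
    using that unfolding E Z by simp
  have prod_less: "?ci (x @ y) < ?m" if "x \<in> set Z" "y \<in> set Z" for x y
    using tv that unfolding transversal_def by blast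
  have letter_less: "?ci [a] < ?m" if "a \<in> set sig" for a
    using tv that unfolding transversal_def by blast
  \<comment> \<open>Each letter is replaced by its representative, which is legitimate because the
    context \<open>z\<close> is one of those tested by \<open>E\<close>; the product is then
    represented in \<open>Z\<close> again.\<close>
  have reach: "\<exists>z'\<in>set Z. resid f (z @ v) = resid f z'" if "v \<in> lists (set sig)" "z \<in> set Z" for v z
    using that
  proof (induction v arbitrary: z rule: list.induct)
    case Nil
    then show ?case by auto
  next
    case (Cons a v)
    then have a: "a \<in> set sig" by simp
    define z1 where "z1 = Z ! ?ci [a]"
    have z1: "z1 \<in> set Z" "E z1 [a]" using letter_less[OF a] ci by (auto simp: z1_def)
    define z2 where "z2 = Z ! ?ci (z @ z1)"
    have z2: "z2 \<in> set Z" "E z2 (z @ z1)"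
      using prod_less[OF Cons.prems(2) z1(1)] ci by (auto simp: z2_def)
    have "resid f (z @ [a]) = resid f z2"
      using E_resid[OF z2(2)] z1(2) Cons.prems(2) unfolding E by metis
    then have "resid f ((z @ [a]) @ v) = resid f (z2 @ v)" by (rule resid_append_cong)
    then show ?case using Cons.IH[OF _ z2(1)] Cons.prems(1) by auto
  qed
  have E_all: "E x y \<longleftrightarrow> (\<forall>u. resid f (u @ x) = resid f (u @ y))" for x y
  proof
    assume xy: "E x y"
    show "\<forall>u. resid f (u @ x) = resid f (u @ y)"
    proof
      fix u
      show "resid f (u @ x) = resid f (u @ y)"
      proof (cases "u \<in> lists (set sig)")
        case True
        obtain z where z: "z \<in> set Z" "resid f u = resid f z"
          using reach[OF True, of "[]"] Z by auto
        have "resid f (u @ x) = resid f (z @ x)" using z(2) by (rule resid_append_cong)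
        also have "\<dots> = resid f (z @ y)" using xy z(1) unfolding E by blast
        also have "\<dots> = resid f (u @ y)" using z(2)[symmetric] by (rule resid_append_cong)
        finally show ?thesis .
      next
        case False
        then have "f (u @ w) = None" for w using dom[of "u @ w"] by auto
        then show ?thesis by (simp add: resid_def)
      qed
    qed
  qed (simp add: E)
  \<comment> \<open>Left compatibility moves \<open>v\<close> into the context, so it relies on
    \<open>E_all\<close> and not on the contexts in \<open>Z\<close> alone.\<close>
  have E_left: "E (v @ x) (v @ y)" if "E x y" for x y v
    using that unfolding E_all append_assoc[symmetric] by blast
  have tab_nth: "?tab ! a ! b = ?ci (Z ! a @ Z ! b)" if "a < ?m" "b < ?m" for a b
    using that by (simp add: table_def)
  have tab_less: "?tab ! a ! b < ?m" and tab_E: "E (Z ! (?tab ! a ! b)) (Z ! a @ Z ! b)"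
    if "a < ?m" "b < ?m" for a b
    using prod_less[of "Z ! a" "Z ! b"] that ci by (simp_all add: tab_nth)
  have inj: "a = b" if "a < ?m" "b < ?m" "E (Z ! a) (Z ! b)" for a b
    using ci_eq[OF that(3)] ci_nth that(1,2) by simp
  have assoc: "?tab ! (?tab ! a ! b) ! c = ?tab ! a ! (?tab ! b ! c)"
    if abc: "a < ?m" "b < ?m" "c < ?m" for a b c
  proof (rule inj)
    show "?tab ! (?tab ! a ! b) ! c < ?m" "?tab ! a ! (?tab ! b ! c) < ?m"
      using abc by (simp_all add: tab_less)
    have "E (Z ! (?tab ! (?tab ! a ! b) ! c)) (Z ! (?tab ! a ! b) @ Z ! c)"
      using abc tab_less by (intro tab_E)
    also have "E (Z ! (?tab ! a ! b) @ Z ! c) ((Z ! a @ Z ! b) @ Z ! c)"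
      using abc tab_E by (intro E_right)
    finally (E_trans) have 1: "E (Z ! (?tab ! (?tab ! a ! b) ! c)) (Z ! a @ Z ! b @ Z ! c)" by simp
    have "E (Z ! (?tab ! a ! (?tab ! b ! c))) (Z ! a @ Z ! (?tab ! b ! c))"
      using abc tab_less by (intro tab_E)
    also have "E (Z ! a @ Z ! (?tab ! b ! c)) (Z ! a @ Z ! b @ Z ! c)"
      using abc tab_E by (intro E_left)
    finally (E_trans) have "E (Z ! (?tab ! a ! (?tab ! b ! c))) (Z ! a @ Z ! b @ Z ! c)" .
    with 1 show "E (Z ! (?tab ! (?tab ! a ! b) ! c)) (Z ! (?tab ! a ! (?tab ! b ! c)))"
      using E_sym E_trans by blast
  qed
  have unit: "?tab ! 0 ! a = a" "?tab ! a ! 0 = a" if "a < ?m" for a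
  proof -
    have "0 < ?m" "Z ! 0 = []" by (simp_all add: Z)
    then show "?tab ! 0 ! a = a" "?tab ! a ! 0 = a" using that by (simp_all add: tab_nth ci_nth)
  qed
  have "0 < ?m" "length ?tab = ?m" "\<forall>row\<in>set ?tab. length row = ?m \<and> (\<forall>x\<in>set row. x < ?m)"
    using prod_less by (auto simp: table_def) (simp add: Z)
  moreover have "length ?img = length sig" "\<forall>x\<in>set ?img. x < ?m"
    using letter_less by (auto simp: letter_images_def)
  ultimately show "valid_pres sig ?m ?tab 0 ?img"
    unfolding valid_pres_def using sig assoc unit by blast
  have img: "the (map_of (zip sig ?img) a) = ?ci [a]" if "a \<in> set sig" for a
    using that by (simp add: letter_images_def map_of_zip_map)
  have morph: "pres_morph sig ?tab 0 ?img u < ?m \<and> E (Z ! pres_morph sig ?tab 0 ?img u) u"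
    if "u \<in> lists (set sig)" for u
    using that
  proof (induction u rule: rev_induct)
    case Nil
    then show ?case by (simp add: pres_morph_def Z E_refl)
  next
    case (snoc a u)
    define k where "k = pres_morph sig ?tab 0 ?img u"
    have a: "a \<in> set sig" and k: "k < ?m" "E (Z ! k) u" using snoc by (auto simp: k_def)
    have "pres_morph sig ?tab 0 ?img (u @ [a]) = ?tab ! k ! ?ci [a]"
      using img[OF a] by (simp add: pres_morph_def k_def)
    moreover have "E (Z ! (?tab ! k ! ?ci [a])) (u @ [a])"
      using tab_E[OF k(1) letter_less[OF a]] E_left[OF ci[OF letter_less[OF a]], of "Z ! k"]
        E_right[OF k(2), of "[a]"] E_trans by blast
    ultimately show ?case using tab_less[OF k(1) letter_less[OF a]] by simp
  qed
  have "pres_morph sig ?tab 0 ?img u = pres_morph sig ?tab 0 ?img v \<longleftrightarrow> E u v"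
    if "u \<in> lists (set sig)" "v \<in> lists (set sig)" for u v
    using morph[OF that(1)] morph[OF that(2)] inj E_sym E_trans by metis
  then show "pres_cong sig ?tab 0 ?img = syn_cong (set sig) f"
    unfolding pres_cong_def syn_cong_def E_all by auto
qed

text \<open>One representative per class is taken. The list is chosen before \<open>E\<close>,
  because in a certificate the relation is itself defined from the list.\<close>

lemma ex_transversal:
  fixes f :: "nat list \<Rightarrow> 'b list option"
  assumes fin: "finite (lists (set sig) // syn_cong (set sig) f)"
    and dom: "\<And>u. f u \<noteq> None \<Longrightarrow> u \<in> lists (set sig)"
  shows "\<exists>Z'. \<forall>E. (\<forall>x y. E x y \<longleftrightarrow> (\<forall>z\<in>set ([] # Z'). resid f (z @ x) = resid f (z @ y))) \<longrightarrow>
    transversal E ([] # Z') sig"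
proof -
  let ?\<Sigma> = "set sig" and ?R = "syn_cong (set sig) f"
  \<comment> \<open>The class of the empty word must be represented by \<open>[]\<close>, the fixed
    head of the list, or that class would appear twice.\<close>
  define rep where "rep C = (if [] \<in> C then [] else SOME x. x \<in> C)" for C :: "nat list set"
  have rep: "rep C \<in> C" if "C \<in> lists ?\<Sigma> // ?R" for C
  proof -
    have "C \<noteq> {}" using that equiv_syn_cong in_quotient_imp_non_empty by blast
    then show ?thesis using someI_ex[of "\<lambda>x. x \<in> C"] by (auto simp: rep_def)
  qed
  have "finite (rep ` (lists ?\<Sigma> // ?R) - {[]})" using fin by simp
  from finite_distinct_list[OF this]
  obtain Z' where Z': "set Z' = rep ` (lists ?\<Sigma> // ?R) - {[]}" "distinct Z'"
    by (elim exE conjE)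
  let ?Z = "[] # Z'"
  have "rep (?R `` {[]}) = []"
    by (simp add: rep_def syn_cong_def)
  then have "[] \<in> rep ` (lists ?\<Sigma> // ?R)"
    using quotientI[of "[]" "lists ?\<Sigma>" ?R] by (metis image_eqI lists.Nil)
  then have setZ: "set ?Z = rep ` (lists ?\<Sigma> // ?R)" and distinct: "distinct ?Z"
    using Z' by auto
  have repr: "\<exists>z\<in>set ?Z. (z, x) \<in> ?R" if "x \<in> lists ?\<Sigma>" for x
  proof -
    have "?R `` {x} \<in> lists ?\<Sigma> // ?R" using that by (rule quotientI)
    then have "rep (?R `` {x}) \<in> set ?Z" "rep (?R `` {x}) \<in> ?R `` {x}"
      using setZ rep by blast+
    then show ?thesis using equiv_syn_cong[of ?\<Sigma> f] by (meson Image_singleton_iff equiv_def symE)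
  qed
  have lists: "z \<in> lists ?\<Sigma>" if "z \<in> set ?Z" for z
  proof -
    obtain C where C: "C \<in> lists ?\<Sigma> // ?R" "z = rep C"
      using \<open>z \<in> set ?Z\<close> unfolding setZ by (rule imageE)
    then show ?thesis using rep[OF C(1)] in_quotient_imp_subset[OF equiv_syn_cong C(1)] by blast
  qed
  have "transversal E ?Z sig"
    if E: "\<And>x y. E x y \<longleftrightarrow> (\<forall>z\<in>set ?Z. resid f (z @ x) = resid f (z @ y))" for E
  proof -
    have E_R: "E x y \<longleftrightarrow> (x, y) \<in> ?R" if "x \<in> lists ?\<Sigma>" "y \<in> lists ?\<Sigma>" for x y
    proof
      assume xy: "E x y"
      have "resid f (u @ x) = resid f (u @ y)" for u
      proof (cases "u \<in> lists ?\<Sigma>")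
        case True
        then obtain z where z: "z \<in> set ?Z" "(z, u) \<in> ?R" using repr by blast
        then have "resid f z = resid f u" using syn_cong_imp_resid_eq by blast
        then show ?thesis using xy z(1) resid_append_cong unfolding E by metis
      next
        case False
        then have "f (u @ w) = None" for w using dom[of "u @ w"] by auto
        then show ?thesis by (simp add: resid_def)
      qed
      then show "(x, y) \<in> ?R" using that by (simp add: syn_cong_def)
    qed (simp add: E syn_cong_def)
    have less: "class_index E ?Z x < length ?Z" if "x \<in> lists ?\<Sigma>" for x
      unfolding class_index_less_iff using repr[OF that] E_R[OF lists that] by blast
    have "class_index E ?Z (?Z ! i) = i" if i: "i < length ?Z" for i
    proof -
      define k where "k = class_index E ?Z (?Z ! i)"
      have mem_i: "?Z ! i \<in> set ?Z" using i by (rule nth_mem)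
      have k: "k < length ?Z" unfolding k_def by (rule less[OF lists[OF mem_i]])
      have mem_k: "?Z ! k \<in> set ?Z" using k by (rule nth_mem)
      have "E (?Z ! k) (?Z ! i)" using k unfolding k_def by (rule class_index_less)
      then have R: "(?Z ! k, ?Z ! i) \<in> ?R" unfolding E_R[OF lists[OF mem_k] lists[OF mem_i]] .
      obtain C where C: "C \<in> lists ?\<Sigma> // ?R" "?Z ! k = rep C"
        using mem_k unfolding setZ by (rule imageE)
      obtain D where D: "D \<in> lists ?\<Sigma> // ?R" "?Z ! i = rep D"
        using mem_i unfolding setZ by (rule imageE)
      have "C = D"
        using R quotient_eqI[OF equiv_syn_cong C(1) D(1) rep[OF C(1)] rep[OF D(1)]]
        unfolding C(2) D(2) by blast
      then have "?Z ! k = ?Z ! i" unfolding C(2) D(2) by (rule arg_cong)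
      then show ?thesis
        using nth_eq_iff_index_eq[OF distinct k i] unfolding k_def by blast
    qed
    then have "map (class_index E ?Z) ?Z = [0..<length ?Z]"
      by (intro nth_equalityI) (simp_all del: list.map upt_Suc)
    then show ?thesis unfolding transversal_def using less lists by simp
  qed
  then show ?thesis by blast
qed

section \<open>Computing with certificates\<close>

lemma computable_strip_common [computable_intros]:
  assumes "computable f" "computable g"
  shows "computable (\<lambda>x. strip_common (f x) (g x))"
proof -
  \<comment> \<open>One step cancels equal first letters; at a mismatch or an exhausted word the
    pair is a fixed point, so \<open>length (f x)\<close> iterations suffice.\<close>
  define pop where "pop p = (case fst p of [] \<Rightarrow> p | x # xs \<Rightarrow>
    (case snd p of [] \<Rightarrow> p | y # ys \<Rightarrow> if x = y then (xs, ys) else p))" for p :: "'b list \<times> 'b list"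
  have pop_fixed: "(pop ^^ k) p = p" if "pop p = p" for k p
    using that by (induction k) simp_all
  have "(pop ^^ length xs) (xs, ys) = strip_common xs ys" for xs ys
  proof (induction xs ys rule: strip_common.induct)
    case (1 x xs y ys)
    show ?case
    proof (cases "x = y")
      case True
      with 1 show ?thesis by (simp add: funpow_Suc_right pop_def del: funpow.simps)
    next
      case False
      then show ?thesis by (subst pop_fixed) (simp_all add: pop_def)
    qed
  next
    case ("2_2" xs)
    have "pop (xs, []) = (xs, [])" by (simp add: pop_def split: list.split)
    then show ?case by (simp add: pop_fixed)
  qed simp
  moreover have "computable (\<lambda>x. (pop ^^ length (f x)) (f x, g x))"
    unfolding pop_def by (intro computable_intros assms)
  ultimately show ?thesis by simp
qed

text \<open>A configuration is a list holding at most one pair of a state and the output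
  produced so far; the empty list stands for the sink.\<close>

type_synonym config = "(nat \<times> nat list) list"

definition step :: "(nat \<times> nat \<times> nat \<times> nat list) list \<Rightarrow> config \<Rightarrow> nat \<Rightarrow> config" where
  "step trs c a = concat (map (\<lambda>(p, acc). concat (map (\<lambda>(p', a', q, w).
     if p' = p \<and> a' = a then [(q, acc @ w)] else []) trs)) c)"

definition run_from :: "(nat \<times> nat \<times> nat \<times> nat list) list \<Rightarrow> config \<Rightarrow> nat list \<Rightarrow> config" where
  "run_from trs c w = foldl (step trs) c w"

definition outputs :: "(nat \<times> nat \<times> nat \<times> nat list) list \<Rightarrow> (nat \<times> nat list) list \<Rightarrow>
    config \<Rightarrow> nat list \<Rightarrow> nat list list" where
  "outputs trs fin c w = concat (map (\<lambda>(q, acc). concat (map (\<lambda>(q', t).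
     if q' = q then [acc @ t] else []) fin)) (run_from trs c w))"

text \<open>An executable form of \<open>shape\<close>: for configurations of length at most 1, the
  result has at most one entry and plays the role of the option.\<close>

definition comparisons :: "(nat \<times> nat \<times> nat \<times> nat list) list \<Rightarrow> (nat \<times> nat list) list \<Rightarrow>
    config \<Rightarrow> nat list \<Rightarrow> nat list \<Rightarrow> (nat list \<times> nat list) list" where
  "comparisons trs fin c w w' =
     concat (map (\<lambda>x. map (strip_common x) (outputs trs fin c w')) (outputs trs fin c w))"

definition indist :: "(nat \<times> nat \<times> nat \<times> nat list) list \<Rightarrow> (nat \<times> nat list) list \<Rightarrow>
    nat list list \<Rightarrow> config \<Rightarrow> config \<Rightarrow> bool" where
  "indist trs fin W c c' \<longleftrightarrow>
     (\<forall>w\<in>set W. \<forall>w'\<in>set W. comparisons trs fin c w w' = comparisons trs fin c' w w')"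

text \<open>Accumulated output is a common prefix and does not affect shapes, so the sink and the
  states with empty accumulator represent all configurations that occur.\<close>

definition start_configs :: "nat \<Rightarrow> config list" where
  "start_configs n = [] # map (\<lambda>p. [(p, [])]) [0..<n]"

definition extend_list :: "nat list \<Rightarrow> nat list list \<Rightarrow> nat list list" where
  "extend_list sig W = [] # W @ concat (map (\<lambda>a. map ((#) a) W) sig)"

definition saturated :: "nat list \<Rightarrow> nat \<Rightarrow> (nat \<times> nat \<times> nat \<times> nat list) list \<Rightarrow>
    (nat \<times> nat list) list \<Rightarrow> nat list list \<Rightarrow> bool" where
  "saturated sig n trs fin W \<longleftrightarrow> (\<forall>c\<in>set (start_configs n). \<forall>c'\<in>set (start_configs n).
     indist trs fin W c c' \<longrightarrow> indist trs fin (extend_list sig W) c c')"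

definition eqv :: "nat \<Rightarrow> (nat \<times> nat \<times> nat \<times> nat list) list \<Rightarrow> (nat \<times> nat list) list \<Rightarrow>
    nat list list \<Rightarrow> nat list list \<Rightarrow> nat list \<Rightarrow> nat list \<Rightarrow> bool" where
  "eqv q0 trs fin W Z x y \<longleftrightarrow> (\<forall>z\<in>set Z.
     indist trs fin W (run_from trs [(q0, [])] (z @ x)) (run_from trs [(q0, [])] (z @ y)))"

type_synonym transducer =
  "nat list \<times> nat \<times> nat \<times> nat list \<times> (nat \<times> nat \<times> nat \<times> nat list) list \<times> (nat \<times> nat list) list"

text \<open>The empty word is put in front of \<open>Z\<close>, which fixes the unit of the
  presented monoid at index 0 and makes \<open>eqv\<close> compare the residuals of the words
  themselves.\<close>

definition certifies :: "transducer \<Rightarrow> nat list list \<times> nat list list \<Rightarrow> bool" where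
  "certifies = (\<lambda>(sig, n, q0, iout, trs, fin) (W, Z). saturated sig n trs fin W \<and>
     transversal (eqv q0 trs fin W ([] # Z)) ([] # Z) sig)"

definition presentation :: "transducer \<Rightarrow> nat list list \<times> nat list list \<Rightarrow>
    nat list \<times> nat \<times> nat list list \<times> nat \<times> nat list" where
  "presentation = (\<lambda>(sig, n, q0, iout, trs, fin) (W, Z).
     (sig, length ([] # Z), table (eqv q0 trs fin W ([] # Z)) ([] # Z), 0,
       letter_images (eqv q0 trs fin W ([] # Z)) ([] # Z) sig))"

lemma computable_step [computable_intros]:
  assumes "computable trs" "computable c" "computable a"
  shows "computable (\<lambda>x. step (trs x) (c x) (a x))"
  \<comment> \<open>Under bound variables the parameter occurs as a projection of a tuple, so the
    assumptions are used in composition with a further computable map.\<close>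
  unfolding step_def by (intro computable_intros assms[THEN computable_comp])

lemma computable_run_from [computable_intros]:
  assumes "computable trs" "computable c" "computable w"
  shows "computable (\<lambda>x. run_from (trs x) (c x) (w x))"
  unfolding run_from_def by (intro computable_intros assms[THEN computable_comp])

lemma computable_outputs [computable_intros]:
  assumes "computable trs" "computable fin" "computable c" "computable w"
  shows "computable (\<lambda>x. outputs (trs x) (fin x) (c x) (w x))"
  unfolding outputs_def by (intro computable_intros assms[THEN computable_comp])

lemma computable_comparisons [computable_intros]:
  assumes "computable trs" "computable fin" "computable c" "computable w" "computable w'"
  shows "computable (\<lambda>x. comparisons (trs x) (fin x) (c x) (w x) (w' x))"
  unfolding comparisons_def by (intro computable_intros assms[THEN computable_comp])

lemma decidable_indist [computable_intros]:
  assumes "computable trs" "computable fin" "computable W" "computable c" "computable c'"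
  shows "decidable (\<lambda>x. indist (trs x) (fin x) (W x) (c x) (c' x))"
  unfolding indist_def by (intro computable_intros assms[THEN computable_comp])

lemma computable_start_configs [computable_intros]:
  assumes "computable n"
  shows "computable (\<lambda>x. start_configs (n x))"
  unfolding start_configs_def by (intro computable_intros assms[THEN computable_comp])

lemma computable_extend_list [computable_intros]:
  assumes "computable sig" "computable W"
  shows "computable (\<lambda>x. extend_list (sig x) (W x))"
  unfolding extend_list_def by (intro computable_intros assms[THEN computable_comp])

lemma decidable_saturated [computable_intros]:
  assumes "computable sig" "computable n" "computable trs" "computable fin" "computable W"
  shows "decidable (\<lambda>x. saturated (sig x) (n x) (trs x) (fin x) (W x))"
  unfolding saturated_def by (intro computable_intros assms[THEN computable_comp])

lemma decidable_eqv [computable_intros]: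
  assumes "computable q0" "computable trs" "computable fin" "computable W" "computable Z"
    "computable u" "computable v"
  shows "decidable (\<lambda>x. eqv (q0 x) (trs x) (fin x) (W x) (Z x) (u x) (v x))"
  unfolding eqv_def by (intro computable_intros assms[THEN computable_comp])

lemma decidable_certifies: "decidable (\<lambda>q. certifies (snd q) (fst q))"
  unfolding certifies_def transversal_def class_index_def case_prod_beta
  by (intro computable_intros)

lemma computable_presentation: "computable (\<lambda>q. presentation (fst q) (snd q))"
  unfolding presentation_def table_def letter_images_def class_index_def case_prod_beta
  by (intro computable_intros)

section \<open>Correctness of certificates and the theorem\<close>

text \<open>Lookup by filtering a table with distinct keys. It is how determinism of transitions and
  uniqueness of final outputs bound the length of configurations and outputs.\<close>

lemma length_concat_unique_key:
  assumes "distinct (map k xs)"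
  shows "length (concat (map (\<lambda>e. if k e = z then [g e] else []) xs)) \<le> 1"
proof -
  have none: "concat (map (\<lambda>e. if k e = z then [g e] else []) ys) = []" if "z \<notin> k ` set ys" for ys
    using that by (auto simp: image_iff)
  from assms show ?thesis
  proof (induction xs)
    case (Cons x xs)
    then show ?case using none[of xs] by (cases "k x = z") auto
  qed simp
qed

lemma length_concat_le_1:
  assumes "length xs \<le> 1" "\<And>x. length (g x) \<le> 1"
  shows "length (concat (map g xs)) \<le> 1"
  using assms by (cases xs) auto

locale sequential_input =
  fixes sig n q0 iout trs fin
  assumes valid: "valid_seq sig n q0 iout trs fin"
begin

definition delta :: "(nat \<times> nat \<times> nat) set" where
  "delta = (\<lambda>(p, a, q, w). (p, a, q)) ` set trs"

definition out :: "nat \<times> nat \<times> nat \<Rightarrow> nat list" where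
  "out = (\<lambda>d. the (map_of (map (\<lambda>(p, a, q, w). ((p, a, q), w)) trs) d))"

definition final_out :: "nat \<Rightarrow> nat list" where
  "final_out = (\<lambda>q. the (map_of fin q))"

definition f :: "nat list \<Rightarrow> nat list option" where
  "f = seq_transduction q0 iout trs fin"

lemma trs_unique:
  assumes "(p, a, q, w) \<in> set trs" "(p, a, q', w') \<in> set trs"
  shows "q = q'" "w = w'"
proof -
  have "inj_on (\<lambda>(p, a, q, w). (p, a)) (set trs)"
    using valid by (simp add: valid_seq_def distinct_map)
  from inj_onD[OF this _ assms] show "q = q'" "w = w'" by simp_all
qed

lemma trs_bounds:
  assumes "(p, a, q, w) \<in> set trs"
  shows "p < n" "a \<in> set sig" "q < n" "w \<in> lists (set sig)"
proof -
  have "\<forall>(p, a, q, w) \<in> set trs. p < n \<and> a \<in> set sig \<and> q < n \<and> w \<in> lists (set sig)"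
    using valid by (simp add: valid_seq_def)
  from bspec[OF this assms] show "p < n" "a \<in> set sig" "q < n" "w \<in> lists (set sig)"
    by simp_all
qed

lemma trs_iff: "(p, a, q, w) \<in> set trs \<longleftrightarrow> (p, a, q) \<in> delta \<and> w = out (p, a, q)"
proof -
  have "distinct trs" using valid by (simp add: valid_seq_def distinct_map)
  moreover have "inj_on (\<lambda>x. (fst x, fst (snd x), fst (snd (snd x)))) (set trs)"
    by (intro inj_onI) (auto dest: trs_unique)
  ultimately have "distinct (map fst (map (\<lambda>(p, a, q, w). ((p, a, q), w)) trs))"
    by (simp add: comp_def case_prod_beta distinct_map)
  then have out: "out (p, a, q) = w" if "(p, a, q, w) \<in> set trs" for w
    using that unfolding out_def by (subst map_of_is_SomeI[where y = w]) force+
  show ?thesis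
  proof
    assume "(p, a, q, w) \<in> set trs"
    then show "(p, a, q) \<in> delta \<and> w = out (p, a, q)"
      using out unfolding delta_def by force
  next
    assume *: "(p, a, q) \<in> delta \<and> w = out (p, a, q)"
    then obtain w' where "(p, a, q, w') \<in> set trs" unfolding delta_def by auto
    with * out show "(p, a, q, w) \<in> set trs" by metis
  qed
qed

lemma fin_iff: "(q, t) \<in> set fin \<longleftrightarrow> q \<in> fst ` set fin \<and> t = final_out q"
proof -
  have "distinct (map fst fin)" using valid by (simp add: valid_seq_def)
  then have "final_out q = t" if "(q, t) \<in> set fin" for t
    using that unfolding final_out_def by simp
  then show ?thesis by (force simp: image_iff)
qed

lemma delta_subset: "delta \<subseteq> {..<n} \<times> set sig \<times> {..<n}"
  using trs_bounds unfolding delta_def by auto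

lemma det: "deterministic {q0} delta"
  unfolding deterministic_def using trs_iff trs_unique(1) by (metis is_singletonI is_singleton_altdef)

lemma set_run_from: "(q, y) \<in> set (run_from trs c w) \<longleftrightarrow>
    (\<exists>p acc v. (p, acc) \<in> set c \<and> tr delta out p w v q \<and> y = acc @ v)"
proof (induction w arbitrary: c)
  case Nil
  show ?case by (auto simp: run_from_def)
next
  case (Cons a w)
  have step: "(r, z) \<in> set (step trs c a) \<longleftrightarrow>
      (\<exists>p acc. (p, acc) \<in> set c \<and> (p, a, r) \<in> delta \<and> z = acc @ out (p, a, r))" for r z
  proof -
    have "(r, z) \<in> set (step trs c a) \<longleftrightarrow>
        (\<exists>p acc w. (p, acc) \<in> set c \<and> (p, a, r, w) \<in> set trs \<and> z = acc @ w)"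
      unfolding step_def by (force split: if_splits)
    then show ?thesis unfolding trs_iff by auto
  qed
  have "run_from trs c (a # w) = run_from trs (step trs c a) w"
    by (simp add: run_from_def)
  then show ?case unfolding Cons.IH step tr.simps
    by (simp only: Cons.IH step) (metis append_assoc)
qed

lemma set_outputs: "y \<in> set (outputs trs fin c w) \<longleftrightarrow>
    (\<exists>p acc v q. (p, acc) \<in> set c \<and> tr delta out p w v q \<and> q \<in> fst ` set fin \<and>
      y = acc @ v @ final_out q)"
proof -
  have "y \<in> set (outputs trs fin c w) \<longleftrightarrow>
      (\<exists>q z t. (q, z) \<in> set (run_from trs c w) \<and> (q, t) \<in> set fin \<and> y = z @ t)"
    unfolding outputs_def by (force split: if_splits)
  then show ?thesis unfolding set_run_from fin_iff by (metis append_assoc)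
qed

lemma length_run_from:
  assumes "length c \<le> 1"
  shows "length (run_from trs c w) \<le> 1"
proof -
  have "length (step trs c a) \<le> 1" if "length c \<le> 1" for c a
    unfolding step_def
  proof (intro length_concat_le_1[OF that])
    fix x :: "nat \<times> nat list"
    obtain p acc where x: "x = (p, acc)" by fastforce
    have eq: "(\<lambda>(p', a', q, w). if p' = p \<and> a' = a then [(q, acc @ w)] else []) =
      (\<lambda>e. if (\<lambda>(p, a, q, w). (p, a)) e = (p, a)
         then [(\<lambda>(p, a, q, w). (q, acc @ w)) e] else [])"
      by (auto simp: fun_eq_iff)
    show "length (case x of (p, acc) \<Rightarrow> concat (map (\<lambda>(p', a', q, w).
        if p' = p \<and> a' = a then [(q, acc @ w)] else []) trs)) \<le> 1"
      unfolding x prod.case eq using valid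
      by (intro length_concat_unique_key) (simp add: valid_seq_def)
  qed
  with assms show ?thesis
    unfolding run_from_def by (induction w arbitrary: c) auto
qed

lemma length_outputs:
  assumes "length c \<le> 1"
  shows "length (outputs trs fin c w) \<le> 1"
  unfolding outputs_def
proof (intro length_concat_le_1[OF length_run_from[OF assms]])
  fix x :: "nat \<times> nat list"
  obtain q acc where x: "x = (q, acc)" by fastforce
  have "(\<lambda>(q', t). if q' = q then [acc @ t] else []) =
    (\<lambda>e. if fst e = q then [acc @ snd e] else [])"
    by (auto simp: fun_eq_iff)
  then show "length (case x of (q, acc) \<Rightarrow> concat (map (\<lambda>(q', t).
      if q' = q then [acc @ t] else []) fin)) \<le> 1"
    using length_concat_unique_key[of fst fin q] valid unfolding x by (simp add: valid_seq_def)
qed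

section \<open>Configurations as partial functions\<close>

definition denote :: "config \<Rightarrow> nat list \<Rightarrow> nat list option" where
  "denote c w = (case outputs trs fin c w of [] \<Rightarrow> None | y # _ \<Rightarrow> Some y)"

lemma outputs_eq_denote:
  assumes "length c \<le> 1"
  shows "outputs trs fin c w = (case denote c w of None \<Rightarrow> [] | Some y \<Rightarrow> [y])"
  using length_outputs[OF assms, of w] unfolding denote_def
  by (cases "outputs trs fin c w") auto

lemma denote_eq_Some_iff:
  assumes "length c \<le> 1"
  shows "denote c w = Some y \<longleftrightarrow> y \<in> set (outputs trs fin c w)"
  unfolding outputs_eq_denote[OF assms] by (cases "denote c w") auto

lemma indist_iff_agree:
  assumes "length c \<le> 1" "length c' \<le> 1"
  shows "indist trs fin W c c' \<longleftrightarrow> agree (set W) (denote c) (denote c')"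
proof -
  have "comparisons trs fin c w w' = (case shape (denote c) w w' of None \<Rightarrow> [] | Some z \<Rightarrow> [z])"
    if "length c \<le> 1" for c w w'
    unfolding comparisons_def outputs_eq_denote[OF that] by (simp add: shape_def split: option.split)
  then have "comparisons trs fin c w w' = comparisons trs fin c' w w' \<longleftrightarrow>
      shape (denote c) w w' = shape (denote c') w w'" for w w'
    using assms by (auto split: option.splits)
  then show ?thesis by (simp add: indist_def agree_def)
qed

lemma denote_run_from: "denote (run_from trs c u) = (\<lambda>w. denote c (u @ w))"
  by (rule ext) (simp add: denote_def outputs_def run_from_def)

lemma f_eq: "f w = map_option ((@) iout) (denote [(q0, [])] w)"
proof (rule option_eqI)
  fix y
  let ?R = "realized delta {q0} (fst ` set fin) out (\<lambda>_. iout) final_out"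
  have "f w = transduction_of ?R w"
    by (simp add: f_def seq_transduction_def delta_def out_def final_out_def)
  also have "\<dots> = Some y \<longleftrightarrow> (w, y) \<in> ?R"
    by (rule transduction_of_eq_Some_iff)
      (metis realized_iff_tr singletonD tr_unique[OF det])
  also have "\<dots> \<longleftrightarrow> (\<exists>z\<in>set (outputs trs fin [(q0, [])] w). y = iout @ z)"
    unfolding realized_iff_tr Bex_def set_outputs by auto
  also have "\<dots> \<longleftrightarrow> map_option ((@) iout) (denote [(q0, [])] w) = Some y"
    unfolding map_option_eq_Some using denote_eq_Some_iff[of "[(q0, [])]" w] by auto
  finally show "f w = Some y \<longleftrightarrow> map_option ((@) iout) (denote [(q0, [])] w) = Some y" .
qed

text \<open>The initial output is a prefix common to all values and vanishes in the shape, so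
  residuals can be computed by running configurations.\<close>

lemma resid_f: "resid f u = shape (denote (run_from trs [(q0, [])] u))"
  unfolding resid_def f_eq denote_run_from by (rule shape_map_append)

lemma f_lists:
  assumes "f u = Some y"
  shows "u \<in> lists (set sig) \<and> y \<in> lists (set sig)"
proof -
  obtain v q where v: "tr delta out q0 u v q" "q \<in> fst ` set fin" "y = iout @ v @ final_out q"
    using assms unfolding f_eq by (auto simp: denote_eq_Some_iff set_outputs)
  have "out d \<in> lists (set sig)" if "d \<in> delta" for d
  proof -
    obtain p a q where d: "d = (p, a, q)" by (cases d)
    then have "(p, a, q, out d) \<in> set trs" using that by (simp add: trs_iff)
    then show ?thesis by (rule trs_bounds)
  qed
  then have "u \<in> lists (set sig) \<and> v \<in> lists (set sig)"
    using delta_subset by (intro tr_lists[OF _ _ v(1)]) auto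
  moreover have "final_out q \<in> lists (set sig)"
  proof -
    have "(q, final_out q) \<in> set fin" using v(2) fin_iff by blast
    moreover have "\<forall>(q, w) \<in> set fin. q < n \<and> w \<in> lists (set sig)"
      using valid by (simp add: valid_seq_def)
    ultimately show ?thesis by blast
  qed
  moreover have "iout \<in> lists (set sig)" using valid by (simp add: valid_seq_def)
  ultimately show ?thesis using v(3) by simp
qed

definition small :: "config \<Rightarrow> bool" where
  "small c \<longleftrightarrow> length c \<le> 1 \<and> fst ` set c \<subseteq> {..<n}"

lemma small_run_from:
  assumes "small c"
  shows "small (run_from trs c u)"
proof -
  have "q < n" if "(q, y) \<in> set (run_from trs c u)" for q y
  proof -
    from that obtain p acc v where p: "(p, acc) \<in> set c" "tr delta out p u v q"
      unfolding set_run_from by blast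
    then have "p \<in> {..<n}" using assms by (force simp: small_def)
    then show ?thesis using tr_in_states[OF delta_subset _ p(2)] by simp
  qed
  then show ?thesis using length_run_from assms by (auto simp: small_def)
qed

lemma small_init: "small [(q0, [])]"
  using valid by (simp add: small_def valid_seq_def)

lemma small_start_configs: "c \<in> set (start_configs n) \<Longrightarrow> small c"
  by (auto simp: start_configs_def small_def)

lemma start_config_of_small:
  assumes "small c"
  obtains c' where "c' \<in> set (start_configs n)" "shape (denote c') = shape (denote c)"
proof (cases c)
  case Nil
  then show thesis by (intro that[of "[]"]) (simp_all add: start_configs_def)
next
  case (Cons x xs)
  then obtain p acc where c: "c = [(p, acc)]" "p < n"
    using assms by (cases x) (auto simp: small_def)
  have "denote c w = map_option ((@) acc) (denote [(p, [])] w)" for w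
  proof (rule option_eqI)
    show "denote c w = Some y \<longleftrightarrow> map_option ((@) acc) (denote [(p, [])] w) = Some y" for y
      unfolding map_option_eq_Some by (auto simp: denote_eq_Some_iff set_outputs c(1))
  qed
  then have "denote c = (\<lambda>w. map_option ((@) acc) (denote [(p, [])] w))" by blast
  then have "shape (denote [(p, [])]) = shape (denote c)" by (simp only: shape_map_append)
  with c(2) show thesis by (intro that[of "[(p, [])]"]) (auto simp: start_configs_def)
qed

lemma set_extend_list: "set (extend_list sig W) = extend (set sig) (set W)"
  by (auto simp: extend_list_def extend_def)

lemma indist_iff_agree_small:
  "small c \<Longrightarrow> small c' \<Longrightarrow> indist trs fin W c c' \<longleftrightarrow> agree (set W) (denote c) (denote c')"
  by (rule indist_iff_agree) (simp_all add: small_def)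

lemma indist_iff_shape_eq:
  assumes sat: "saturated sig n trs fin W" and c: "small c" "small c'"
  shows "indist trs fin W c c' \<longleftrightarrow> shape (denote c) = shape (denote c')"
proof
  assume "indist trs fin W c c'"
  then have agr: "agree (set W) (denote c) (denote c')"
    using indist_iff_agree_small c by blast
  obtain d where d: "d \<in> set (start_configs n)" "shape (denote d) = shape (denote c)"
    using start_config_of_small[OF c(1)] .
  obtain d' where d': "d' \<in> set (start_configs n)" "shape (denote d') = shape (denote c')"
    using start_config_of_small[OF c(2)] .
  \<comment> \<open>This set contains the nowhere defined function, denoted by the sink, and up to
    shape it is closed under reading a letter. \<open>saturated\<close> is the stability condition
    on it.\<close>
  let ?K = "denote ` set (start_configs n)"
  have "shape (denote d) = shape (denote d')"
  proof (rule agree_imp_shape_eq[where K = ?K and \<Sigma> = "set sig" and W = "set W"])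
    have "denote [] = (\<lambda>_. None)"
      by (intro ext option_eqI) (auto simp: denote_eq_Some_iff set_outputs)
    then show "(\<lambda>_. None) \<in> ?K" by (intro image_eqI[of _ _ "[]"]) (simp_all add: start_configs_def)
  next
    fix h a assume "h \<in> ?K"
    then obtain e where e: "e \<in> set (start_configs n)" "h = denote e" by blast
    have "(\<lambda>w. h (a # w)) = denote (run_from trs e [a])"
      by (simp add: denote_run_from e(2))
    moreover obtain e' where "e' \<in> set (start_configs n)"
      "shape (denote e') = shape (denote (run_from trs e [a]))"
      using start_config_of_small[OF small_run_from[OF small_start_configs[OF e(1)]]] .
    ultimately show "\<exists>h'\<in>?K. shape h' = shape (\<lambda>w. h (a # w))" by auto
  next
    fix h a w assume "h \<in> ?K" and a: "a \<notin> set sig"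
    then obtain e where e: "e \<in> set (start_configs n)" "h = denote e" by blast
    have "h (a # w) \<noteq> Some y" for y
      using a delta_subset small_start_configs[OF e(1)] unfolding e(2)
      by (auto simp: denote_eq_Some_iff small_def set_outputs)
    then show "h (a # w) = None" by auto
  next
    fix h h' assume "h \<in> ?K" "h' \<in> ?K" and agr': "agree (set W) h h'"
    then obtain e e' where e: "e \<in> set (start_configs n)" "h = denote e"
      "e' \<in> set (start_configs n)" "h' = denote e'" by blast
    then have "indist trs fin W e e'"
      using agr' small_start_configs by (simp add: indist_iff_agree_small)
    then have "indist trs fin (extend_list sig W) e e'"
      using sat e unfolding saturated_def by blast
    then show "agree (extend (set sig) (set W)) h h'"
      using e small_start_configs by (simp add: indist_iff_agree_small set_extend_list)
  next
    show "agree (set W) (denote d) (denote d')" using agr agree_cong[OF d(2) d'(2)] by blast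
  qed (use d d' in auto)
  then show "shape (denote c) = shape (denote c')" using d d' by simp
next
  assume "shape (denote c) = shape (denote c')"
  then show "indist trs fin W c c'" using c by (simp add: indist_iff_agree_small agree_def)
qed

text \<open>With a separating set as \<open>W\<close>, indistinguishable start configurations have
  equal shapes, and equal shapes agree on any further test words.\<close>

lemma ex_saturated: "\<exists>W. saturated sig n trs fin W"
proof -
  let ?K = "denote ` set (start_configs n)"
  have "finite ?K" by simp
  then obtain S where S: "finite S"
    "\<And>h h'. h \<in> ?K \<Longrightarrow> h' \<in> ?K \<Longrightarrow> agree S h h' \<Longrightarrow> shape h = shape h'"
    by (rule finite_separating_set) blast
  obtain W where W: "set W = S" using finite_list[OF S(1)] by blast
  have "indist trs fin (extend_list sig W) c c'"
    if c: "c \<in> set (start_configs n)" "c' \<in> set (start_configs n)" and "indist trs fin W c c'" for c c'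
  proof -
    have "agree S (denote c) (denote c')"
      using that small_start_configs by (simp add: indist_iff_agree_small W)
    then have "shape (denote c) = shape (denote c')" using S(2) c by blast
    then show ?thesis using c small_start_configs by (simp add: indist_iff_agree_small agree_def)
  qed
  then show ?thesis unfolding saturated_def by blast
qed

lemma eqv_iff:
  assumes "saturated sig n trs fin W"
  shows "eqv q0 trs fin W Z x y \<longleftrightarrow> (\<forall>z\<in>set Z. resid f (z @ x) = resid f (z @ y))"
  unfolding eqv_def resid_f using indist_iff_shape_eq[OF assms] small_run_from small_init by blast

lemma f_dom: "f u \<noteq> None \<Longrightarrow> u \<in> lists (set sig)"
  using f_lists by blast

lemma certifies_correct:
  assumes "certifies (sig, n, q0, iout, trs, fin) (W, Z)"
  obtains m tab img where "presentation (sig, n, q0, iout, trs, fin) (W, Z) = (sig, m, tab, 0, img)"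
    "valid_pres sig m tab 0 img" "pres_cong sig tab 0 img = syn_cong (set sig) f"
proof -
  let ?Z = "[] # Z"
  let ?E = "eqv q0 trs fin W ?Z"
  have sat: "saturated sig n trs fin W" and tv: "transversal ?E ?Z sig"
    using assms by (simp_all add: certifies_def)
  have sig: "distinct sig" using valid by (simp add: valid_seq_def)
  note correct = presentation_correct[OF eqv_iff[OF sat] refl tv sig f_dom]
  show thesis
    by (rule that[OF _ correct]) (simp_all add: presentation_def)
qed

text \<open>Every residual is the shape of a start configuration, so there are finitely many
  residuals; hence the congruence has finite index and representatives exist.\<close>

lemma ex_certificate: "\<exists>y. certifies (sig, n, q0, iout, trs, fin) y"
proof -
  obtain W where W: "saturated sig n trs fin W" using ex_saturated by blast
  have "range (resid f) \<subseteq> (\<lambda>c. shape (denote c)) ` set (start_configs n)"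
  proof
    fix \<rho> assume "\<rho> \<in> range (resid f)"
    then obtain u where "\<rho> = shape (denote (run_from trs [(q0, [])] u))"
      unfolding resid_f by blast
    then show "\<rho> \<in> (\<lambda>c. shape (denote c)) ` set (start_configs n)"
      using start_config_of_small[OF small_run_from[OF small_init, of u]] by (metis image_eqI)
  qed
  then have "finite (range (resid f))" by (rule finite_subset) simp
  then have fin: "finite (lists (set sig) // syn_cong (set sig) f)"
    by (rule finite_quotient_syn_cong)
  obtain Z where Z: "\<forall>E. (\<forall>x y. E x y \<longleftrightarrow> (\<forall>z\<in>set ([] # Z). resid f (z @ x) = resid f (z @ y)))
      \<longrightarrow> transversal E ([] # Z) sig"
    using ex_transversal[OF fin f_dom] by (rule exE)
  have "transversal (eqv q0 trs fin W ([] # Z)) ([] # Z) sig"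
    by (rule Z[rule_format]) (rule eqv_iff[OF W])
  with W have "certifies (sig, n, q0, iout, trs, fin) (W, Z)"
    by (simp add: certifies_def)
  then show ?thesis by blast
qed

end

section \<open>Agreement of the codes and the decision procedure\<close>

lemma enc_list_eq: "Defs.enc_list xs = enc xs"
  by (induction xs) simp_all

lemma enc_pres_eq: "enc_pres sig m tab e img = enc (sig, m, tab, e, img)"
proof -
  have "Defs.enc_list (map Defs.enc_list tab) = enc tab"
    by (induction tab) (simp_all add: enc_list_eq)
  then show ?thesis by (simp add: enc_pres_def enc_list_eq)
qed

lemma enc_seq_eq: "enc_seq sig n q0 iout trs fin = enc (sig, n, q0, iout, trs, fin)"
proof -
  have "Defs.enc_list (map (\<lambda>(p, a, q, w). prod_encode (p, prod_encode (a, prod_encode (q, Defs.enc_list w)))) trs)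
    = enc trs"
    by (induction trs) (auto simp: enc_list_eq)
  moreover have "Defs.enc_list (map (\<lambda>(q, w). prod_encode (q, Defs.enc_list w)) fin) = enc fin"
    by (induction fin) (auto simp: enc_list_eq)
  ultimately show ?thesis by (simp add: enc_seq_def enc_list_eq)
qed

theorem theorem2p1:
  assumes "congruence_class V"
    and "decidable_class V"
  shows "\<exists>r. \<forall>sig n q0 iout trs fin. valid_seq sig n q0 iout trs fin \<longrightarrow>
           eval_rf r (enc_seq sig n q0 iout trs fin)
             (if V_sequential V (set sig) (seq_transduction q0 iout trs fin) then 1 else 0)"
proof -
  obtain rV where rV: "\<And>sig m tab e img. valid_pres sig m tab e img \<Longrightarrow>
      eval_rf rV (enc (sig, m, tab, e, img)) (if pres_cong sig tab e img \<in> V (set sig) then 1 else 0)"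
    using assms(2) unfolding decidable_class_def enc_pres_eq by blast
  obtain rS where rS: "\<And>x. \<exists>y. certifies x y \<Longrightarrow> \<exists>y. certifies x y \<and> eval_rf rS (enc x) (enc y)"
    using computable_search[OF decidable_certifies] by blast
  obtain rP where rP: "\<And>q. eval_rf rP (enc q) (enc (presentation (fst q) (snd q)))"
    using computable_presentation by (rule computableE) blast
  \<comment> \<open>\<open>Pair Fst Snd\<close> computes the identity and keeps the input next to
    the certificate found, as the presentation is built from both.\<close>
  define r where "r = Comp rV (Comp rP (Pair (Pair Fst Snd) rS))"
  have "eval_rf r (enc_seq sig n q0 iout trs fin)
      (if V_sequential V (set sig) (seq_transduction q0 iout trs fin) then 1 else 0)"
    if "valid_seq sig n q0 iout trs fin" for sig n q0 iout trs fin
  proof -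
    interpret sequential_input sig n q0 iout trs fin by standard (rule that)
    let ?x = "(sig, n, q0, iout, trs, fin)"
    \<comment> \<open>Any certificate will do: \<open>certifies_correct\<close> shows that each one
      presents the same congruence.\<close>
    obtain y where y: "certifies ?x y" "eval_rf rS (enc ?x) (enc y)"
      using rS[OF ex_certificate] by blast
    obtain W Z where WZ: "y = (W, Z)" by fastforce
    obtain m tab img where pres: "presentation ?x y = (sig, m, tab, 0, img)"
      "valid_pres sig m tab 0 img" "pres_cong sig tab 0 img = syn_cong (set sig) f"
      using certifies_correct[OF y(1)[unfolded WZ]] unfolding WZ by blast
    have "eval_rf (Pair (Pair Fst Snd) rS) (enc ?x) (enc (?x, y))"
      unfolding enc_Pair[of ?x y] using eval_rf_id y(2) by (rule eval_rf.pair)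
    moreover have "eval_rf rP (enc (?x, y)) (enc (sig, m, tab, 0 :: nat, img))"
      using rP[of "(?x, y)"] unfolding fst_conv snd_conv pres(1) .
    moreover have "eval_rf rV (enc (sig, m, tab, 0 :: nat, img))
        (if syn_cong (set sig) f \<in> V (set sig) then 1 else 0)"
      using rV[OF pres(2)] unfolding pres(3) .
    ultimately have "eval_rf r (enc ?x) (if syn_cong (set sig) f \<in> V (set sig) then 1 else 0)"
      unfolding r_def by (intro eval_rf.comp)
    then show ?thesis
      unfolding enc_seq_eq f_def[symmetric]
      using V_sequential_iff_syn_cong[OF assms(1), of "set sig" f] f_lists by simp
  qed
  then show ?thesis by blast
qed

end
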